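(* For $n\ge1$ and $e\ge1$ let $R_{n,e}=k[X,Y,Z]/\langle X^nY-(Y^2-X^eZ)^2-1\rangle$. Then $$R_{n,e_1}\otimes_kk[T]\simeq R_{n,e_2}\otimes_kk[T]$$ for every $n,e_1,e_2>0$. In addition, suppose $e_1<e_2$ and, for $0\le i<e_2-e_1$, let $\phi_{e_1+i,e_1+i+1}$ be the explicit endomorphism of $k^{[4]}=k[X,Y,Z,T]$ constructed in the context (for the given $n$ and with $e=e_1+i$), which induces an isomorphism between $R_{n,e_1+i}[T]$ and $R_{n,e_1+i+1}[T]$. Then the endomorphism $\phi_{e_2-1,e_2}\circ\cdots\circ\phi_{e_1,e_1+1}$ of $k^{[4]}$ induces an isomorphism between $R_{n,e_1}[T]$ and $R_{n,e_2}[T]$.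
   Context: $k$ is a field of characteristic zero; isomorphisms are of $k$-algebras, and $R_{n,e}[T]=R_{n,e}\otimes_kk[T]=k[X,Y,Z,T]/\langle F_{n,e}\rangle$ with $F_{n,e}=X^nY-(Y^2-X^eZ)^2-1$. An endomorphism $\phi$ of $k^{[4]}$ induces an isomorphism between $R_{n,e}[T]$ and $R_{n,e'}[T]$ if $\phi(F_{n,e})\in\langle F_{n,e'}\rangle$ and the induced homomorphism $k^{[4]}/\langle F_{n,e}\rangle\to k^{[4]}/\langle F_{n,e'}\rangle$ is an isomorphism. Construction of $\phi_{e,e+1}$ (for fixed $n\ge1$, $e\ge1$). Let $\Phi$ be the endomorphism of $k[X,S,Y,Z,T]$ with $\Phi(X)=X$, $\Phi(S)=S+H$, $\Phi(Y)=Y+L$, $\Phi(Z)=XZ+F$, where $H=X^{n+e}T$, and where $L\in k[X,S,T]$, $F\in k[X,S,Y,T]$ and $\Phi(T)\in k[X,S,Y,Z,T]$ are determined by the requirements (a) $\Phi(X^nY-S^2-1)=X^nY-S^2-1$, i.e. $X^nL=2HS+H^2$; (b) $\Phi(Y^2-X^eZ-S)=Y^2-X^{e+1}Z-S$, i.e. $X^eF=2YL+L^2-H$; (c) $\Phi(YZ-XT)=4T(-X^nY)+4TS(Y^2-X^{e+1}Z)$, which is congruent to $-4T$ modulo $\langle X^nY-S^2-1,\ Y^2-X^{e+1}Z-S\rangle$. Then $\phi_{e,e+1}$ is the endomorphism of $k[X,Y,Z,T]$ sending $X,Y,Z,T$ to $\Phi(X),\Phi(Y),\Phi(Z),\Phi(T)$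 with $S$ replaced by $Y^2-X^{e+1}Z$. For example, for $n=e=1$: $H=X^2T$, $\Phi(Y)=Y+2XST+X^3T^2$ and $\Phi(Z)=XZ+4SYT-XT+2X^2YT^2+4XS^2T^2+4X^3ST^3+X^5T^4$. *)

theory Defs
  imports "HOL-Algebra.Module" "HOL-Algebra.QuotRing" "HOL-Library.Poly_Mapping"
begin

section \<open>Algebras over a field\<close>

text \<open>
  A commutative algebra over the field \<open>'k\<close> is represented by the record type
  \<open>('k, 'a) module\<close>: a ring structure on a carrier, together with a scalar multiplication.
\<close>

definition alg_hom :: "('k, 'a) module \<Rightarrow> ('k, 'b) module \<Rightarrow> ('a \<Rightarrow> 'b) set" where
  "alg_hom A B = {h \<in> ring_hom A B. \<forall>c. \<forall>a \<in> carrier A. h (c \<odot>\<^bsub>A\<^esub> a) = c \<odot>\<^bsub>B\<^esub> h a}"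

definition alg_iso :: "('k, 'a) module \<Rightarrow> ('k, 'b) module \<Rightarrow> ('a \<Rightarrow> 'b) set" where
  "alg_iso A B = alg_hom A B \<inter> ring_iso A B"

definition alg_isomorphic :: "('k, 'a) module \<Rightarrow> ('k, 'b) module \<Rightarrow> bool" where
  "alg_isomorphic A B \<longleftrightarrow> alg_iso A B \<noteq> {}"

text \<open>The quotient ring \<open>A Quot I\<close>, with the scalar multiplication \<open>c \<odot> (I +> a) = I +> (c \<odot> a)\<close>.\<close>

definition alg_quot :: "('k, 'a) module \<Rightarrow> 'a set \<Rightarrow> ('k, 'a set) module" where
  "alg_quot A I = ring.extend (A Quot I)
     (module.fields (\<lambda>c U. \<Union>a\<in>U. I +>\<^bsub>A\<^esub> (c \<odot>\<^bsub>A\<^esub> a)))"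

text \<open>
  The tensor product \<open>A \<otimes>\<^sub>k B\<close> is the quotient of the free \<open>k\<close>-vector space on
  \<open>carrier A \<times> carrier B\<close> by the bilinearity relations, with the multiplication induced by
  \<open>(a, b) * (a', b') = (a a', b b')\<close>. The product of a relation with a basis element is again
  a relation, so the ideal generated by the relations is just their linear span.
\<close>

definition pair_alg ::
  "('k::field, 'a) module \<Rightarrow> ('k, 'b) module \<Rightarrow> ('k, ('a \<times> 'b) \<Rightarrow>\<^sub>0 'k) module" where
  "pair_alg A B =
    \<lparr>carrier = {f. Poly_Mapping.keys f \<subseteq> carrier A \<times> carrier B},
     mult = (\<lambda>f g. \<Sum>p\<in>Poly_Mapping.keys f. \<Sum>q\<in>Poly_Mapping.keys g.
        Poly_Mapping.single (fst p \<otimes>\<^bsub>A\<^esub> fst q, snd p \<otimes>\<^bsub>B\<^esub> snd q) (Poly_Mapping.lookup f p * Poly_Mapping.lookup g q)),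
     one = Poly_Mapping.single (\<one>\<^bsub>A\<^esub>, \<one>\<^bsub>B\<^esub>) 1,
     zero = 0,
     add = (+),
     smult = (\<lambda>c. Poly_Mapping.map ((*) c))\<rparr>"

definition tensor_relations ::
  "('k::field, 'a) module \<Rightarrow> ('k, 'b) module \<Rightarrow> (('a \<times> 'b) \<Rightarrow>\<^sub>0 'k) set" where
  "tensor_relations A B =
     {Poly_Mapping.single (a \<oplus>\<^bsub>A\<^esub> a', b) 1 - Poly_Mapping.single (a, b) 1 - Poly_Mapping.single (a', b) 1
        | a a' b. a \<in> carrier A \<and> a' \<in> carrier A \<and> b \<in> carrier B} \<union>
     {Poly_Mapping.single (a, b \<oplus>\<^bsub>B\<^esub> b') 1 - Poly_Mapping.single (a, b) 1 - Poly_Mapping.single (a, b') 1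
        | a b b'. a \<in> carrier A \<and> b \<in> carrier B \<and> b' \<in> carrier B} \<union>
     {Poly_Mapping.single (c \<odot>\<^bsub>A\<^esub> a, b) 1 - Poly_Mapping.single (a, b) c
        | c a b. a \<in> carrier A \<and> b \<in> carrier B} \<union>
     {Poly_Mapping.single (a, c \<odot>\<^bsub>B\<^esub> b) 1 - Poly_Mapping.single (a, b) c
        | c a b. a \<in> carrier A \<and> b \<in> carrier B}"

definition tensor_alg ::
  "('k::field, 'a) module \<Rightarrow> ('k, 'b) module \<Rightarrow> ('k, (('a \<times> 'b) \<Rightarrow>\<^sub>0 'k) set) module" where
  "tensor_alg A B = alg_quot (pair_alg A B) (Idl\<^bsub>pair_alg A B\<^esub> (tensor_relations A B))"


section \<open>Polynomials in the indeterminates \<open>X, S, Y, Z, T\<close>\<close>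

datatype indet = IX | IS | IY | IZ | IT

text \<open>Monomials are finitely supported exponent functions.\<close>

type_synonym 'k mp = "(indet \<Rightarrow>\<^sub>0 nat) \<Rightarrow>\<^sub>0 'k"

definition Var :: "indet \<Rightarrow> 'k::field mp" where
  "Var v = Poly_Mapping.single (Poly_Mapping.single v 1) 1"

abbreviation "pX \<equiv> Var IX"
abbreviation "pS \<equiv> Var IS"
abbreviation "pY \<equiv> Var IY"
abbreviation "pZ \<equiv> Var IZ"
abbreviation "pT \<equiv> Var IT"

definition Const :: "'k::field \<Rightarrow> 'k mp" where
  "Const c = Poly_Mapping.single 0 c"

definition indets :: "'k::field mp \<Rightarrow> indet set" where
  "indets p = (\<Union>m\<in>Poly_Mapping.keys p. Poly_Mapping.keys m)"

text \<open>\<open>poly_alg V\<close> is the polynomial algebra \<open>k[V]\<close>, as a subalgebra of \<open>k[X,S,Y,Z,T]\<close>.\<close>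

definition poly_alg :: "indet set \<Rightarrow> ('k::field, 'k mp) module" where
  "poly_alg V =
    \<lparr>carrier = {p. indets p \<subseteq> V}, mult = (*), one = 1, zero = 0, add = (+),
     smult = (\<lambda>c p. Const c * p)\<rparr>"

text \<open>The endomorphism \<open>v \<mapsto> s v\<close>.\<close>

definition psubst :: "(indet \<Rightarrow> 'k mp) \<Rightarrow> 'k::field mp \<Rightarrow> 'k mp" where
  "psubst s p = (\<Sum>m\<in>Poly_Mapping.keys p. Const (Poly_Mapping.lookup p m) * (\<Prod>v\<in>Poly_Mapping.keys m. s v ^ Poly_Mapping.lookup m v))"


section \<open>The algebras \<open>R\<^sub>n\<^sub>,\<^sub>e\<close> and the endomorphisms \<open>\<phi>\<^sub>e\<^sub>,\<^sub>e\<^sub>+\<^sub>1\<close>\<close>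

definition Fpoly :: "nat \<Rightarrow> nat \<Rightarrow> 'k::field mp" where
  "Fpoly n e = pX ^ n * pY - (pY\<^sup>2 - pX ^ e * pZ)\<^sup>2 - 1"

definition Ralg :: "nat \<Rightarrow> nat \<Rightarrow> ('k::field, 'k mp set) module" where
  "Ralg n e = alg_quot (poly_alg {IX, IY, IZ}) (PIdl\<^bsub>poly_alg {IX, IY, IZ}\<^esub> (Fpoly n e))"

abbreviation k4 :: "('k::field, 'k mp) module" where
  "k4 \<equiv> poly_alg {IX, IY, IZ, IT}"

text \<open>
  The endomorphism \<open>\<Phi>\<close> of \<open>k[X,S,Y,Z,T]\<close>. The requirements have exactly one solution: as
  \<open>X\<close> is not a zero divisor, the three equations give in turn
  \<open>L = 2X\<^sup>eTS + X\<^sup>n\<^sup>+\<^sup>2\<^sup>eT\<^sup>2\<close>, \<open>F\<close> and \<open>\<Phi>(T)\<close>.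
\<close>

definition Phi :: "nat \<Rightarrow> nat \<Rightarrow> 'k::field mp \<Rightarrow> 'k mp" where
  "Phi n e = (THE \<Phi>. \<Phi> \<in> alg_hom (poly_alg UNIV) (poly_alg UNIV) \<and>
     \<Phi> pX = pX \<and>
     \<Phi> pS = pS + pX ^ (n + e) * pT \<and>
     (\<exists>L \<in> carrier (poly_alg {IX, IS, IT}). \<Phi> pY = pY + L) \<and>
     (\<exists>F \<in> carrier (poly_alg {IX, IS, IY, IT}). \<Phi> pZ = pX * pZ + F) \<and>
     \<Phi> (pX ^ n * pY - pS\<^sup>2 - 1) = pX ^ n * pY - pS\<^sup>2 - 1 \<and>
     \<Phi> (pY\<^sup>2 - pX ^ e * pZ - pS) = pY\<^sup>2 - pX ^ (e + 1) * pZ - pS \<and>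
     \<Phi> (pY * pZ - pX * pT) =
       4 * pT * (- (pX ^ n * pY)) + 4 * pT * pS * (pY\<^sup>2 - pX ^ (e + 1) * pZ))"

text \<open>
  \<open>\<phi>\<^sub>e\<^sub>,\<^sub>e\<^sub>+\<^sub>1\<close> is only meant as an endomorphism of \<open>k4\<close>, so its value at \<open>S\<close> is irrelevant.
\<close>

definition phi :: "nat \<Rightarrow> nat \<Rightarrow> 'k::field mp \<Rightarrow> 'k mp" where
  "phi n e = psubst (\<lambda>v. psubst (Var(IS := pY\<^sup>2 - pX ^ (e + 1) * pZ)) (Phi n e (Var v)))"

text \<open>\<open>phi_comp n e m\<close> is \<open>\<phi>\<^bsub>e+m-1,e+m\<^esub> \<circ> \<dots> \<circ> \<phi>\<^bsub>e,e+1\<^esub>\<close>.\<close>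

primrec phi_comp :: "nat \<Rightarrow> nat \<Rightarrow> nat \<Rightarrow> 'k::field mp \<Rightarrow> 'k mp" where
  "phi_comp n e 0 = id"
| "phi_comp n e (Suc m) = phi n (e + m) \<circ> phi_comp n e m"

text \<open>
  The homomorphism \<open>k4/I \<rightarrow> k4/J\<close> induced by \<open>\<phi>\<close> sends the coset \<open>I +> p\<close> to \<open>J +> \<phi> p\<close>.
\<close>

definition induced_map :: "'k::field mp set \<Rightarrow> ('k mp \<Rightarrow> 'k mp) \<Rightarrow> 'k mp set \<Rightarrow> 'k mp set" where
  "induced_map J \<phi> U = (\<Union>p\<in>U. J +>\<^bsub>k4\<^esub> \<phi> p)"

definition induces_iso :: "('k::field mp \<Rightarrow> 'k mp) \<Rightarrow> 'k mp \<Rightarrow> 'k mp \<Rightarrow> bool" where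
  "induces_iso \<phi> f g \<longleftrightarrow>
     \<phi> \<in> alg_hom k4 k4 \<and>
     \<phi> f \<in> PIdl\<^bsub>k4\<^esub> g \<and>
     induced_map (PIdl\<^bsub>k4\<^esub> g) \<phi> \<in> alg_iso (alg_quot k4 (PIdl\<^bsub>k4\<^esub> f)) (alg_quot k4 (PIdl\<^bsub>k4\<^esub> g))"

end

theory Submission
  imports Defs
begin

text \<open>
  Write \<open>s = Y\<^sup>2 - X\<^sup>eZ\<close>, so that \<open>R\<^sub>n\<^sub>,\<^sub>e[T]\<close> is \<open>k[X,S,Y,Z,T]\<close> modulo
  \<open>X\<^sup>nY = S\<^sup>2 + 1\<close> and \<open>X\<^sup>eZ = Y\<^sup>2 - S\<close>. Away from \<open>X = 0\<close> the coordinates \<open>Y\<close> and \<open>Z\<close> are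
  determined by \<open>X\<close> and \<open>S\<close>, and \<open>T\<close> may be replaced by \<open>YZ - XT\<close>. The map
  \<open>\<phi>\<^sub>e\<^sub>,\<^sub>e\<^sub>+\<^sub>1\<close> sends \<open>S\<close> to \<open>S + X\<^sup>n\<^sup>+\<^sup>eT\<close> and, modulo the relations, \<open>YZ - XT\<close> to
  \<open>-4T\<close>; this is visibly invertible once \<open>X\<close> is. It remains invertible over \<open>X = 0\<close> because an
  inverse \<open>\<psi>\<close> can be written down without dividing by \<open>X\<close>. The image of \<open>YZ - XT\<close> forces
  \<open>\<psi>(T) = -(YZ - XT)/4\<close>, the only place where the characteristic matters. Undoing the triangular
  substitution gives \<open>\<psi>\<close> on \<open>S\<close>, on \<open>Y\<close> and on \<open>XZ\<close>, and the formula for \<open>\<phi>(T)\<close>, whose only term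
  outside \<open>k[X,S,Y,T,XZ]\<close> is \<open>YZ\<close>, gives \<open>\<psi>\<close> on \<open>YZ\<close>. Finally \<open>\<psi>(Z)\<close> is recovered from
  \<open>Z = (X\<^sup>nY - S\<^sup>2)Z = X\<^sup>n(YZ) - SY(YZ) + SX\<^sup>e\<^sup>-\<^sup>1(XZ)\<^sup>2\<close>, an identity modulo \<open>F\<^sub>n\<^sub>,\<^sub>e\<^sub>+\<^sub>1\<close>.
  That \<open>\<psi>\<close> is well defined and inverse to \<open>\<phi>\<close> consists of congruences in an arbitrary commutative
  ring, lemmas \<open>inverse_coordinates\<close> and \<open>inverse_coordinates_converse\<close>.

  Being inverse modulo the two ideals is stable under composition
  (\<open>mutually_inverse_mod_trans\<close>), so the composite of the \<open>\<phi>\<^sub>e\<^sub>,\<^sub>e\<^sub>+\<^sub>1\<close> also induces an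
  isomorphism. To pass to tensor products, \<open>tensor_isomorphic\<close> identifies
  \<open>(k[V]/\<langle>f\<rangle>) \<otimes> k[w]\<close> with \<open>k[V,w]/\<langle>f\<rangle>\<close> for an indeterminate \<open>w\<close> outside \<open>V\<close>: multiplying out tensors
  is a surjective homomorphism, and splitting each monomial into its \<open>V\<close>-part and its power of \<open>w\<close>
  shows that its kernel is the ideal of the bilinearity relations.
\<close>

section \<open>Polynomials and substitution\<close>

text \<open>
  The carriers of polynomial subalgebras and of the algebra of formal pairs are both given by a
  restriction on the support, so the induction has to stay inside a prescribed set of keys.
\<close>

lemma poly_mapping_single_induct [consumes 1, case_names zero single add]:
  assumes "Poly_Mapping.keys f \<subseteq> C" and "P 0"
    and "\<And>k c. k \<in> C \<Longrightarrow> P (Poly_Mapping.single k c)"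
    and "\<And>f g. Poly_Mapping.keys f \<subseteq> C \<Longrightarrow> Poly_Mapping.keys g \<subseteq> C \<Longrightarrow> P f \<Longrightarrow> P g \<Longrightarrow> P (f + g)"
  shows "P (f :: 'a \<Rightarrow>\<^sub>0 'b::comm_monoid_add)"
proof -
  let ?s = "\<lambda>K. \<Sum>k\<in>K. Poly_Mapping.single k (Poly_Mapping.lookup f k)"
  have "f = ?s (Poly_Mapping.keys f)"
    by (rule poly_mapping_eqI)
      (auto simp: lookup_sum lookup_single when_def in_keys_iff)
  moreover have "Poly_Mapping.keys (?s K) \<subseteq> C \<and> P (?s K)" if "finite K" "K \<subseteq> C" for K
    using that
  proof (induction K)
    case empty
    then show ?case using assms(2) by simp
  next
    case (insert k K)
    have "Poly_Mapping.keys (Poly_Mapping.single k (Poly_Mapping.lookup f k)) \<subseteq> C"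
      using insert.prems by (simp add: keys_single)
    then show ?case
      using insert assms(3)[of k] assms(4)
        keys_add[of "Poly_Mapping.single k (Poly_Mapping.lookup f k)" "?s K"]
      by (simp; blast)
  qed
  ultimately show ?thesis
    using assms(1) finite_keys by metis
qed

text \<open>
  The linear extension of a map given on basis elements. The coefficient is passed to
  \<open>h\<close> because the target need not carry a scalar multiplication.
\<close>

definition lin_ext :: "('a \<Rightarrow> 'b \<Rightarrow> 'c) \<Rightarrow> ('a \<Rightarrow>\<^sub>0 'b::comm_monoid_add) \<Rightarrow> 'c::comm_monoid_add"
  where "lin_ext h f = (\<Sum>k\<in>Poly_Mapping.keys f. h k (Poly_Mapping.lookup f k))"

lemma lin_ext_0 [simp]: "lin_ext h 0 = 0"
  by (simp add: lin_ext_def)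

lemma lin_ext_single: "(\<And>k. h k 0 = 0) \<Longrightarrow> lin_ext h (Poly_Mapping.single k c) = h k c"
  by (simp add: lin_ext_def)

lemma lin_ext_add:
  assumes "\<And>k. h k 0 = 0" and add: "\<And>k c d. h k (c + d) = h k c + h k d"
  shows "lin_ext h (f + g) = lin_ext h f + lin_ext h g"
proof -
  let ?K = "Poly_Mapping.keys f \<union> Poly_Mapping.keys g"
  have "lin_ext h r = (\<Sum>k\<in>?K. h k (Poly_Mapping.lookup r k))" if "r \<in> {f, g, f + g}" for r
    unfolding lin_ext_def using that keys_add[of f g]
    by (intro sum.mono_neutral_left) (auto simp: in_keys_iff assms(1))
  then show ?thesis
    by (simp add: lookup_add add sum.distrib)
qed

instance indet :: finite
proof
  have "(UNIV :: indet set) = {IX, IS, IY, IZ, IT}"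
    using indet.exhaust by auto
  then show "finite (UNIV :: indet set)"
    by (metis finite.emptyI finite.insertI)
qed

lemma Const_0 [simp]: "Const 0 = 0" and Const_1 [simp]: "Const 1 = 1"
  and Const_add: "Const (a + b) = Const a + Const b"
  and Const_mult: "Const (a * b) = Const a * Const b"
  by (simp_all add: Const_def single_add mult_single)

lemma Const_numeral: "Const (numeral k) = numeral k"
  by (simp add: Const_def)

lemma single_eq_Const_times_Vars:
  "Poly_Mapping.single m c = Const c * (\<Prod>v\<in>UNIV. Var v ^ Poly_Mapping.lookup m v)"
proof -
  have pow: "Var v ^ i = (Poly_Mapping.single (Poly_Mapping.single v i) 1 :: 'a mp)" for v i
  proof (induction i)
    case (Suc i)
    then show ?case
      by (simp add: Var_def mult_single flip: single_add)
  qed simp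
  have "(\<Prod>v\<in>A. Var v ^ Poly_Mapping.lookup m v) =
      (Poly_Mapping.single (\<Sum>v\<in>A. Poly_Mapping.single v (Poly_Mapping.lookup m v)) 1 :: 'a mp)"
    for A :: "indet set"
    by (induction A rule: infinite_finite_induct) (simp_all add: pow mult_single)
  moreover have "(\<Sum>v\<in>UNIV. Poly_Mapping.single v (Poly_Mapping.lookup m v)) = m"
    by (rule poly_mapping_eqI) (simp add: lookup_sum lookup_single when_def)
  ultimately show ?thesis
    by (simp add: Const_def mult_single)
qed

lemma psubst_lin_ext:
  "psubst s = lin_ext (\<lambda>m c. Const c * (\<Prod>v\<in>UNIV. s v ^ Poly_Mapping.lookup m v))"
proof
  fix p
  have "(\<Prod>v\<in>Poly_Mapping.keys m. s v ^ Poly_Mapping.lookup m v) =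
        (\<Prod>v\<in>UNIV. s v ^ Poly_Mapping.lookup m v)" for m
    by (rule prod.mono_neutral_left) (auto simp: in_keys_iff)
  then show "psubst s p = lin_ext (\<lambda>m c. Const c * (\<Prod>v\<in>UNIV. s v ^ Poly_Mapping.lookup m v)) p"
    by (simp add: psubst_def lin_ext_def)
qed

lemma psubst_single:
  "psubst s (Poly_Mapping.single m c) = Const c * (\<Prod>v\<in>UNIV. s v ^ Poly_Mapping.lookup m v)"
  by (simp add: psubst_lin_ext lin_ext_single)

lemma psubst_add: "psubst s (p + q) = psubst s p + psubst s q"
  by (simp add: psubst_lin_ext lin_ext_add Const_add distrib_right)

lemma psubst_0 [simp]: "psubst s 0 = 0"
  by (simp add: psubst_def)

lemma psubst_Const [simp]: "psubst s (Const c) = Const c"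
  using psubst_single[of s 0 c] by (simp add: Const_def)

lemma psubst_1 [simp]: "psubst s 1 = 1"
  using psubst_Const[of s 1] by simp

lemma psubst_Var [simp]: "psubst s (Var v) = s v"
proof -
  have "(\<Prod>w\<in>UNIV. s w ^ Poly_Mapping.lookup (Poly_Mapping.single v 1) w) =
      (\<Prod>w\<in>UNIV. if w = v then s w else 1)"
    by (rule prod.cong) (auto simp: lookup_single)
  then show ?thesis
    by (simp add: Var_def psubst_single del: One_nat_def)
qed

lemma psubst_mult: "psubst s (p * q) = psubst s p * psubst s q"
proof -
  have "psubst s (Poly_Mapping.single m c * Poly_Mapping.single m' c') =
      psubst s (Poly_Mapping.single m c) * psubst s (Poly_Mapping.single m' c')" for m m' c c'
    by (simp add: mult_single psubst_single Const_mult lookup_add power_add prod.distrib ac_simps)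
  then have "psubst s (Poly_Mapping.single m c * q) = psubst s (Poly_Mapping.single m c) * psubst s q" for m c
    by (induction q rule: poly_mapping_single_induct[OF subset_UNIV]) (simp_all add: psubst_add algebra_simps)
  then show ?thesis
    by (induction p rule: poly_mapping_single_induct[OF subset_UNIV]) (simp_all add: psubst_add algebra_simps)
qed

lemma psubst_uminus: "psubst s (- p) = - psubst s p"
  using psubst_add[of s p "- p"] by (simp add: minus_unique)

lemma psubst_diff: "psubst s (p - q) = psubst s p - psubst s q"
  using psubst_add[of s p "- q"] by (simp add: psubst_uminus)

lemma psubst_power: "psubst s (p ^ i) = psubst s p ^ i"
  by (induction i) (simp_all add: psubst_mult)

lemma psubst_numeral [simp]: "psubst s (numeral k) = numeral k"
  using psubst_Const[of s "numeral k"] by (simp only: Const_numeral)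

lemmas psubst_hom = psubst_add psubst_mult psubst_uminus psubst_diff psubst_power

lemma indets_Const [simp]: "indets (Const c) = {}"
  by (simp add: indets_def Const_def keys_single)

lemma indets_0 [simp]: "indets 0 = {}" and indets_1 [simp]: "indets 1 = {}"
  and indets_numeral [simp]: "indets (numeral k) = {}"
  using indets_Const[of 0] indets_Const[of 1] indets_Const[of "numeral k"]
  by (simp_all only: Const_0 Const_1 Const_numeral)

lemma indets_Var [simp]: "indets (Var v) = {v}"
  by (simp add: indets_def Var_def)

lemma indets_add: "indets p \<subseteq> V \<Longrightarrow> indets q \<subseteq> V \<Longrightarrow> indets (p + q) \<subseteq> V"
  using keys_add[of p q] unfolding indets_def by blast

lemma indets_mult:
  assumes "indets p \<subseteq> V" "indets q \<subseteq> V"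
  shows "indets (p * q) \<subseteq> V"
proof -
  have "Poly_Mapping.keys m \<subseteq> V" if m: "m \<in> Poly_Mapping.keys (p * q)" for m
  proof -
    obtain a b where "m = a + b" "a \<in> Poly_Mapping.keys p" "b \<in> Poly_Mapping.keys q"
      using keys_mult[of p q] m by blast
    then show ?thesis
      using assms keys_add[of a b] unfolding indets_def by blast
  qed
  then show ?thesis
    by (auto simp: indets_def)
qed

lemma indets_uminus [simp]: "indets (- p) = indets p"
  by (simp add: indets_def in_keys_iff set_eq_iff)

lemma indets_diff: "indets p \<subseteq> V \<Longrightarrow> indets q \<subseteq> V \<Longrightarrow> indets (p - q) \<subseteq> V"
  using indets_add[of p V "- q"] by simp

lemma indets_power: "indets p \<subseteq> V \<Longrightarrow> indets (p ^ i) \<subseteq> V"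
  by (induction i) (simp_all add: indets_mult)

lemmas indets_closed = indets_add indets_mult indets_diff indets_power

text \<open>
  The subalgebra of polynomials with indeterminates in \<open>V\<close> is generated by the constants and \<open>V\<close>.
\<close>

lemma poly_induct [consumes 1, case_names Const Var add mult]:
  assumes "indets p \<subseteq> V"
    and Const: "\<And>c. P (Const c)" and Var: "\<And>v. v \<in> V \<Longrightarrow> P (Var v)"
    and add: "\<And>p q. P p \<Longrightarrow> P q \<Longrightarrow> P (p + q)"
    and mult: "\<And>p q. P p \<Longrightarrow> P q \<Longrightarrow> P (p * q)"
  shows "P (p :: 'k::field mp)"
proof -
  have P1: "P 1"
    using Const[of 1] unfolding Const_1 .
  have pow: "P (Var v ^ i)" if "v \<in> V" for v i
    by (induction i) (simp_all add: P1 mult Var that)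
  have mono: "P (Poly_Mapping.single m c)" if keys_V: "Poly_Mapping.keys m \<subseteq> V" for m c
  proof -
    have "P (\<Prod>v\<in>A. Var v ^ Poly_Mapping.lookup m v)" for A
    proof (induction A rule: infinite_finite_induct)
      case (insert v A)
      have "P (Var v ^ Poly_Mapping.lookup m v)"
      proof (cases "v \<in> Poly_Mapping.keys m")
        case True
        then show ?thesis
          using pow keys_V by blast
      next
        case False
        then show ?thesis
          by (simp add: in_keys_iff P1)
      qed
      then show ?case
        using insert by (simp add: mult)
    qed (simp_all add: P1)
    then show ?thesis
      by (simp add: single_eq_Const_times_Vars mult Const)
  qed
  have "Poly_Mapping.keys p \<subseteq> {m. Poly_Mapping.keys m \<subseteq> V}"
    using assms(1) by (auto simp: indets_def)
  then show ?thesis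
    using Const[of 0] by (induction p rule: poly_mapping_single_induct) (simp_all add: mono add)
qed

lemma indets_psubst:
  assumes "indets p \<subseteq> V" and "\<And>v. v \<in> V \<Longrightarrow> indets (s v) \<subseteq> W"
  shows "indets (psubst s p) \<subseteq> W"
  using assms(1) by (induction p rule: poly_induct) (simp_all add: psubst_hom indets_closed assms(2))

text \<open>
  Congruence of two substitutions modulo \<open>g\<close> may be tested on the indeterminates, since polynomial
  operations respect congruence. With \<open>t = Var\<close> this reduces the statement that a composite of
  endomorphisms is the identity modulo an ideal to one check for each indeterminate.
\<close>

lemma psubst_dvd_diff:
  assumes "indets p \<subseteq> V" and "\<And>v. v \<in> V \<Longrightarrow> g dvd s v - t v"
  shows "g dvd psubst s p - psubst t p"
  using assms(1)
proof (induction p rule: poly_induct)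
  case (add p q)
  have "psubst s (p + q) - psubst t (p + q) = (psubst s p - psubst t p) + (psubst s q - psubst t q)"
    by (simp add: psubst_hom)
  then show ?case
    using add by simp
next
  case (mult p q)
  have "psubst s (p * q) - psubst t (p * q) =
      (psubst s p - psubst t p) * psubst s q + psubst t p * (psubst s q - psubst t q)"
    by (simp add: psubst_hom algebra_simps)
  then show ?case
    using mult by simp
qed (simp_all add: assms(2))

lemma psubst_cong:
  assumes "indets p \<subseteq> V" and "\<And>v. v \<in> V \<Longrightarrow> s v = t v"
  shows "psubst s p = psubst t p"
  using psubst_dvd_diff[of p V 0 s t] assms by simp

lemma psubst_Var_id [simp]: "psubst Var p = p"
  by (induction p rule: poly_induct[OF subset_UNIV]) (simp_all add: psubst_hom)

lemma psubst_psubst: "psubst s (psubst t p) = psubst (\<lambda>v. psubst s (t v)) p"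
  by (induction p rule: poly_induct[OF subset_UNIV]) (simp_all add: psubst_hom)

text \<open>
  Multiplication by an indeterminate shifts all exponent vectors injectively. This cancellation is
  what makes the requirements on \<open>\<Phi>\<close> determine it.
\<close>

lemma Var_mult_cancel:
  assumes "Var v * p = Var v * q"
  shows "p = q"
proof (rule poly_mapping_eqI)
  fix k
  let ?m = "Poly_Mapping.single v 1 :: indet \<Rightarrow>\<^sub>0 nat"
  have "Poly_Mapping.lookup (Var v * r) (?m + k) = Poly_Mapping.lookup r k" for r :: "'a mp"
    by (induction r rule: poly_mapping_single_induct[OF subset_UNIV])
      (simp_all add: Var_def mult_single lookup_single when_def distrib_left lookup_add)
  then show "Poly_Mapping.lookup p k = Poly_Mapping.lookup q k"
    using assms by metis
qed

lemma Var_power_mult_cancel: "Var v ^ i * p = Var v ^ i * q \<Longrightarrow> p = q"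
  by (induction i) (auto simp: mult.assoc dest: Var_mult_cancel)

section \<open>Congruences in a commutative ring\<close>

definition cong_mod :: "'a::comm_ring_1 \<Rightarrow> 'a \<Rightarrow> 'a \<Rightarrow> bool" where
  "cong_mod g a b \<longleftrightarrow> g dvd a - b"

lemma cong_mod_refl [simp]: "cong_mod g a a"
  by (simp add: cong_mod_def)

lemma cong_mod_trans [trans]: "cong_mod g a b \<Longrightarrow> cong_mod g b c \<Longrightarrow> cong_mod g a c"
  using dvd_add[of g "a - b" "b - c"] by (simp add: cong_mod_def)

lemma cong_mod_add: "cong_mod g a b \<Longrightarrow> cong_mod g c d \<Longrightarrow> cong_mod g (a + c) (b + d)"
  using dvd_add[of g "a - b" "c - d"] by (simp add: cong_mod_def algebra_simps)

lemma cong_mod_diff: "cong_mod g a b \<Longrightarrow> cong_mod g c d \<Longrightarrow> cong_mod g (a - c) (b - d)"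
  using dvd_diff[of g "a - b" "c - d"] by (simp add: cong_mod_def algebra_simps)

lemma cong_mod_mult:
  assumes "cong_mod g a b" "cong_mod g c d"
  shows "cong_mod g (a * c) (b * d)"
proof -
  have "a * c - b * d = (a - b) * c + b * (c - d)"
    by (simp add: algebra_simps)
  then show ?thesis
    using assms by (simp add: cong_mod_def)
qed

lemma cong_mod_power: "cong_mod g a b \<Longrightarrow> cong_mod g (a ^ i) (b ^ i)"
  by (induction i) (simp_all add: cong_mod_mult)

lemmas cong_mod_intros = cong_mod_add cong_mod_diff cong_mod_mult cong_mod_power cong_mod_refl

section \<open>Explicit form of the endomorphisms\<close>

text \<open>
  The solutions \<open>L\<close>, \<open>F\<close> of the requirements on \<open>\<Phi>\<close>, and \<open>E = \<Phi>(T) - YZ\<close> with \<open>u\<close> standing for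
  \<open>XZ\<close>. They are functions on an arbitrary commutative ring because the inverse evaluates the same
  expressions at other arguments. The factor \<open>M = L / X\<^sup>e\<close> is kept separate because \<open>F\<close> and \<open>E\<close>
  involve \<open>L\<^sup>2 / X\<^sup>e\<close> and \<open>L / X\<close>.
\<close>

definition Mcoef :: "nat \<Rightarrow> nat \<Rightarrow> 'a::comm_ring_1 \<Rightarrow> 'a \<Rightarrow> 'a \<Rightarrow> 'a" where
  "Mcoef n e x s t = 2 * t * s + x ^ (n + e) * t\<^sup>2"

definition Lcoef :: "nat \<Rightarrow> nat \<Rightarrow> 'a::comm_ring_1 \<Rightarrow> 'a \<Rightarrow> 'a \<Rightarrow> 'a" where
  "Lcoef n e x s t = x ^ e * Mcoef n e x s t"

definition Fcoef :: "nat \<Rightarrow> nat \<Rightarrow> 'a::comm_ring_1 \<Rightarrow> 'a \<Rightarrow> 'a \<Rightarrow> 'a \<Rightarrow> 'a" where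
  "Fcoef n e x s y t =
     4 * y * t * s + 2 * x ^ (n + e) * y * t\<^sup>2 + x ^ e * (Mcoef n e x s t)\<^sup>2 - x ^ n * t"

definition Ecoef :: "nat \<Rightarrow> nat \<Rightarrow> 'a::comm_ring_1 \<Rightarrow> 'a \<Rightarrow> 'a \<Rightarrow> 'a \<Rightarrow> 'a \<Rightarrow> 'a" where
  "Ecoef n e x s y t u =
     x ^ (e - 1) * (Mcoef n e x s t + 4 * t * s) * u + 3 * x ^ (n - 1) * t * y
     + 2 * x ^ (n + e - 1) * y\<^sup>2 * t\<^sup>2 + x ^ (e - 1) * y * (Mcoef n e x s t)\<^sup>2
     + x ^ (e - 1) * Mcoef n e x s t * Fcoef n e x s y t"

lemma Lcoef_eq:
  "x ^ n * Lcoef n e x s t = 2 * (x ^ (n + e) * t) * s + (x ^ (n + e) * t)\<^sup>2"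
  by (simp add: Lcoef_def Mcoef_def power_add power2_eq_square algebra_simps)

lemma Fcoef_eq:
  "x ^ e * Fcoef n e x s y t =
     2 * y * Lcoef n e x s t + (Lcoef n e x s t)\<^sup>2 - x ^ (n + e) * t"
  by (simp add: Fcoef_def Lcoef_def Mcoef_def power_add power2_eq_square algebra_simps)

text \<open>
  This is requirement (c) solved for \<open>\<Phi>(T)\<close>. Modulo \<open>x\<close> the correction \<open>L\<close> vanishes and \<open>F\<close>
  becomes \<open>4yts\<close>, so \<open>yF\<close> cancels against \<open>4tsy\<^sup>2\<close>; hence the right-hand side is divisible by \<open>x\<close>,
  and \<open>E\<close> is the quotient.
\<close>

lemma Ecoef_eq:
  assumes "n \<ge> 1" "e \<ge> 1"
  shows "x * Ecoef n e x s y t u =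
    (y + Lcoef n e x s t) * (u + Fcoef n e x s y t) - y * u
    - (4 * t * (- (x ^ n * y)) + 4 * t * s * (y\<^sup>2 - x ^ e * u))"
proof -
  obtain n' e' where [simp]: "n = Suc n'" "e = Suc e'"
    using assms by (metis Suc_le_D One_nat_def)
  define m where "m = Mcoef n e x s t"
  have F: "Fcoef n e x s y t = 4 * y * t * s + 2 * x ^ (n + e) * y * t\<^sup>2 + x ^ e * m\<^sup>2 - x ^ n * t"
    by (simp add: Fcoef_def m_def)
  show ?thesis
    unfolding Ecoef_def Lcoef_def F m_def[symmetric]
    by (simp add: power_add power2_eq_square algebra_simps)
qed

text \<open>
  With \<open>s = S\<close> these are the images of the indeterminates under \<open>\<Phi>\<close>; with
  \<open>s = Y\<^sup>2 - X\<^sup>e\<^sup>+\<^sup>1Z\<close> they are their images under \<open>\<phi>\<^sub>e\<^sub>,\<^sub>e\<^sub>+\<^sub>1\<close>.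
\<close>

definition phi_gen :: "nat \<Rightarrow> nat \<Rightarrow> 'k::field mp \<Rightarrow> indet \<Rightarrow> 'k mp" where
  "phi_gen n e s v = (case v of
     IX \<Rightarrow> pX
   | IS \<Rightarrow> s + pX ^ (n + e) * pT
   | IY \<Rightarrow> pY + Lcoef n e pX s pT
   | IZ \<Rightarrow> pX * pZ + Fcoef n e pX s pY pT
   | IT \<Rightarrow> pY * pZ + Ecoef n e pX s pY pT (pX * pZ))"

lemma psubst_coef:
  "psubst f (Mcoef n e x s t) = Mcoef n e (psubst f x) (psubst f s) (psubst f t)"
  "psubst f (Lcoef n e x s t) = Lcoef n e (psubst f x) (psubst f s) (psubst f t)"
  "psubst f (Fcoef n e x s y t) = Fcoef n e (psubst f x) (psubst f s) (psubst f y) (psubst f t)"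
  "psubst f (Ecoef n e x s y t u) =
     Ecoef n e (psubst f x) (psubst f s) (psubst f y) (psubst f t) (psubst f u)"
  by (simp_all add: Mcoef_def Lcoef_def Fcoef_def Ecoef_def psubst_hom)

lemma indets_coef:
  assumes "indets x \<subseteq> V" "indets s \<subseteq> V" "indets t \<subseteq> V"
  shows "indets (Mcoef n e x s t) \<subseteq> V" "indets (Lcoef n e x s t) \<subseteq> V"
    and "indets y \<subseteq> V \<Longrightarrow> indets (Fcoef n e x s y t) \<subseteq> V"
    and "indets y \<subseteq> V \<Longrightarrow> indets u \<subseteq> V \<Longrightarrow> indets (Ecoef n e x s y t u) \<subseteq> V"
proof -
  show M: "indets (Mcoef n e x s t) \<subseteq> V"
    unfolding Mcoef_def by (intro indets_closed assms) auto
  then show "indets (Lcoef n e x s t) \<subseteq> V"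
    unfolding Lcoef_def by (intro indets_closed assms)
  show F: "indets (Fcoef n e x s y t) \<subseteq> V" if "indets y \<subseteq> V"
    unfolding Fcoef_def by (intro indets_closed assms that M) auto
  show "indets (Ecoef n e x s y t u) \<subseteq> V" if "indets y \<subseteq> V" "indets u \<subseteq> V"
    unfolding Ecoef_def by (intro indets_closed assms that M F) auto
qed

lemma alg_hom_poly_algD:
  assumes "h \<in> alg_hom (poly_alg UNIV) (poly_alg UNIV)"
  shows "h = psubst (\<lambda>v. h (Var v))"
proof
  fix p
  have h: "h (p + q) = h p + h q" "h (p * q) = h p * h q" "h 1 = 1" "h (Const c * p) = Const c * h p"
    for p q c
    using assms by (auto simp: alg_hom_def ring_hom_def poly_alg_def)
  have "h (Const c) = Const c" for c
    using h(4)[of c 1] h(3) by simp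
  then show "h p = psubst (\<lambda>v. h (Var v)) p"
    by (induction p rule: poly_induct[OF subset_UNIV]) (simp_all add: h psubst_hom)
qed

lemma psubst_alg_hom:
  assumes "\<And>v. v \<in> V \<Longrightarrow> indets (s v) \<subseteq> W"
  shows "psubst s \<in> alg_hom (poly_alg V) (poly_alg W)"
  using indets_psubst[OF _ assms]
  by (auto simp: alg_hom_def ring_hom_def poly_alg_def psubst_hom)

text \<open>
  Existence holds by construction of \<open>L\<close>, \<open>F\<close>, \<open>E\<close>. For uniqueness, an algebra homomorphism is a
  substitution, and its values at \<open>Y\<close>, \<open>Z\<close>, \<open>T\<close> are found in this order by cancelling
  \<open>X\<^sup>n\<close>, \<open>X\<^sup>e\<close> and \<open>X\<close> from the three requirements.
\<close>

lemma Phi_eq: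
  assumes "n \<ge> 1" "e \<ge> 1"
  shows "Phi n e = psubst (phi_gen n e pS)"
  unfolding Phi_def
proof (rule the_equality, intro conjI)
  let ?h = "psubst (phi_gen n e pS) :: 'a mp \<Rightarrow> _"
  let ?L = "Lcoef n e pX pS pT :: 'a mp" and ?F = "Fcoef n e pX pS pY pT :: 'a mp"
  show "?h \<in> alg_hom (poly_alg UNIV) (poly_alg UNIV)"
    by (rule psubst_alg_hom) simp
  show "?h pX = pX" "?h pS = pS + pX ^ (n + e) * pT"
    by (simp_all add: phi_gen_def)
  show "\<exists>L\<in>carrier (poly_alg {IX, IS, IT}). ?h pY = pY + L"
    by (rule bexI[of _ ?L]) (simp_all add: phi_gen_def poly_alg_def indets_coef)
  show "\<exists>F\<in>carrier (poly_alg {IX, IS, IY, IT}). ?h pZ = pX * pZ + F"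
    by (rule bexI[of _ ?F]) (simp_all add: phi_gen_def poly_alg_def indets_coef)
  show "?h (pX ^ n * pY - pS\<^sup>2 - 1) = pX ^ n * pY - pS\<^sup>2 - 1"
    using Lcoef_eq[of pX n e pS "pT :: 'a mp"]
    by (simp add: phi_gen_def psubst_hom algebra_simps power2_eq_square)
  show "?h (pY\<^sup>2 - pX ^ e * pZ - pS) = pY\<^sup>2 - pX ^ (e + 1) * pZ - pS"
    using Fcoef_eq[of pX e n pS pY "pT :: 'a mp"]
    by (simp add: phi_gen_def psubst_hom algebra_simps power2_eq_square)
  show "?h (pY * pZ - pX * pT) =
      4 * pT * (- (pX ^ n * pY)) + 4 * pT * pS * (pY\<^sup>2 - pX ^ (e + 1) * pZ)"
    using Ecoef_eq[OF assms, of pX pS pY "pT :: 'a mp" "pX * pZ"]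
    by (simp add: phi_gen_def psubst_hom algebra_simps)
next
  fix h :: "'a mp \<Rightarrow> 'a mp"
  assume "h \<in> alg_hom (poly_alg UNIV) (poly_alg UNIV) \<and> h pX = pX \<and>
     h pS = pS + pX ^ (n + e) * pT \<and>
     (\<exists>L \<in> carrier (poly_alg {IX, IS, IT}). h pY = pY + L) \<and>
     (\<exists>F \<in> carrier (poly_alg {IX, IS, IY, IT}). h pZ = pX * pZ + F) \<and>
     h (pX ^ n * pY - pS\<^sup>2 - 1) = pX ^ n * pY - pS\<^sup>2 - 1 \<and>
     h (pY\<^sup>2 - pX ^ e * pZ - pS) = pY\<^sup>2 - pX ^ (e + 1) * pZ - pS \<and>
     h (pY * pZ - pX * pT) =
       4 * pT * (- (pX ^ n * pY)) + 4 * pT * pS * (pY\<^sup>2 - pX ^ (e + 1) * pZ)"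
  then obtain L F where hom: "h \<in> alg_hom (poly_alg UNIV) (poly_alg UNIV)"
    and X: "h pX = pX" and S: "h pS = pS + pX ^ (n + e) * pT"
    and Y: "h pY = pY + L" and Z: "h pZ = pX * pZ + F"
    and a: "h (pX ^ n * pY - pS\<^sup>2 - 1) = pX ^ n * pY - pS\<^sup>2 - 1"
    and b: "h (pY\<^sup>2 - pX ^ e * pZ - pS) = pY\<^sup>2 - pX ^ (e + 1) * pZ - pS"
    and c: "h (pY * pZ - pX * pT) =
       4 * pT * (- (pX ^ n * pY)) + 4 * pT * pS * (pY\<^sup>2 - pX ^ (e + 1) * pZ)"
    by blast
  note h = alg_hom_poly_algD[OF hom]
  note h_simps = psubst_hom[of "\<lambda>v. h (Var v)", folded h]
  have h1: "h 1 = 1"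
    using psubst_1[of "\<lambda>v. h (Var v)"] unfolding h[symmetric] .
  have "pX ^ n * L = pX ^ n * Lcoef n e pX pS pT"
    using a unfolding Lcoef_eq
    by (simp add: h_simps h1 X Y S algebra_simps power2_eq_square)
  then have L: "L = Lcoef n e pX pS pT"
    by (rule Var_power_mult_cancel)
  have "pX ^ e * F = pX ^ e * Fcoef n e pX pS pY pT"
    using b unfolding Fcoef_eq L[symmetric]
    by (simp add: h_simps X Y S Z algebra_simps power2_eq_square)
  then have F: "F = Fcoef n e pX pS pY pT"
    by (rule Var_power_mult_cancel)
  have "pX * h pT = pX * (pY * pZ + Ecoef n e pX pS pY pT (pX * pZ))"
    using c unfolding distrib_left Ecoef_eq[OF assms] L[symmetric] F[symmetric]
    by (simp add: h_simps X Y Z algebra_simps)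
  then have T: "h pT = pY * pZ + Ecoef n e pX pS pY pT (pX * pZ)"
    by (rule Var_mult_cancel)
  have "h (Var v) = phi_gen n e pS v" for v
    by (cases v) (simp_all add: phi_gen_def X S Y Z L F T)
  then show "h = psubst (phi_gen n e pS)"
    by (subst h) simp
qed

lemma phi_eq:
  assumes "n \<ge> 1" "e \<ge> 1"
  shows "(phi n e :: 'a::field mp \<Rightarrow> _) = psubst (phi_gen n e (pY\<^sup>2 - pX ^ (e + 1) * pZ))"
proof -
  have "psubst (Var(IS := pY\<^sup>2 - pX ^ (e + 1) * pZ)) (Phi n e (Var v)) =
      (phi_gen n e (pY\<^sup>2 - pX ^ (e + 1) * pZ) v :: 'a mp)" for v
    by (cases v) (simp_all add: Phi_eq[OF assms] phi_gen_def psubst_hom psubst_coef)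
  then show ?thesis
    unfolding phi_def by presburger
qed

section \<open>The inverse modulo the defining polynomials\<close>

lemma cong_mod_coef:
  assumes "cong_mod g s s'" "cong_mod g t t'"
  shows "cong_mod g (Lcoef n e x s t) (Lcoef n e x s' t')"
    and "cong_mod g y y' \<Longrightarrow> cong_mod g (Fcoef n e x s y t) (Fcoef n e x s' y' t')"
    and "cong_mod g y y' \<Longrightarrow> cong_mod g u u' \<Longrightarrow>
      cong_mod g (Ecoef n e x s y t u) (Ecoef n e x s' y' t' u')"
  unfolding Ecoef_def Fcoef_def Lcoef_def Mcoef_def
  by (intro cong_mod_intros assms; assumption)+

text \<open>
  The images under the inverse \<open>\<psi>\<close>, seen in any commutative ring: \<open>(x, y0, z0, T)\<close> are the
  coordinates on \<open>R\<^sub>n\<^sub>,\<^sub>e[T]\<close>, \<open>g\<close> is the value of \<open>F\<^sub>n\<^sub>,\<^sub>e\<close>, and \<open>s, y, u, w, z, t\<close> are the candidates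
  for the images of \<open>S, Y, XZ, YZ, Z, T\<close>. The work lies in showing \<open>xz \<equiv> u\<close> and \<open>yz \<equiv> w\<close> modulo
  \<open>g\<close>, that is, that \<open>z\<close> is consistent with the values chosen earlier for \<open>XZ\<close> and \<open>YZ\<close>. After that,
  the first conclusion says that \<open>\<psi>\<close> is well defined and the others that \<open>\<psi> \<circ> \<phi>\<close> is the identity
  on \<open>Y\<close>, \<open>Z\<close> and \<open>T\<close>.
\<close>

lemma inverse_coordinates:
  fixes x :: "'a::comm_ring_1"
  assumes ne: "n \<ge> 1" "e \<ge> 1"
    and t: "4 * t = x * T - y0 * z0"
    and s0: "s0 = y0\<^sup>2 - x ^ e * z0" and g: "g = x ^ n * y0 - s0\<^sup>2 - 1"
    and s: "s = s0 - x ^ (n + e) * t"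
    and y: "y = y0 - Lcoef n e x s t"
    and u: "u = z0 - Fcoef n e x s y t"
    and w: "w = T - Ecoef n e x s y t u"
    and z: "z = x ^ n * w - s * y * w + s * x ^ (e - 1) * u\<^sup>2"
  defines "\<sigma> \<equiv> y\<^sup>2 - x ^ (e + 1) * z"
  shows "cong_mod g (x ^ n * y - \<sigma>\<^sup>2 - 1) 0"
    and "cong_mod g (y + Lcoef n e x \<sigma> t) y0"
    and "cong_mod g (x * z + Fcoef n e x \<sigma> y t) z0"
    and "cong_mod g (y * z + Ecoef n e x \<sigma> y t (x * z)) T"
proof -
  define h where "h = x ^ (n + e) * t"
  let ?L = "Lcoef n e x s t" and ?F = "Fcoef n e x s y t"
  have xx: "x * x ^ (e - 1) = x ^ e"
    using ne(2) by (simp flip: power_Suc)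
  have y0: "y0 = y + ?L" and z0: "z0 = u + ?F" and s0': "s0 = s + h"
    using y u s by (simp_all add: h_def)
  have xny: "x ^ n * y = s\<^sup>2 + 1 + g"
    using Lcoef_eq[of x n e s t] unfolding g y s0' h_def[symmetric]
    by (simp add: power2_eq_square algebra_simps)
  have xeu: "x ^ e * u = y\<^sup>2 - s"
  proof -
    have "x ^ e * u = y0\<^sup>2 - s0 - x ^ e * ?F"
      unfolding s0 u by (simp add: algebra_simps)
    then show ?thesis
      unfolding Fcoef_eq s0' h_def[symmetric]
      by (simp add: y0 power2_eq_square algebra_simps)
  qed
  (* This mirrors \<phi>(YZ - XT) = -4T: there the bracket below equals -4t up to the relations. *)
  have xw: "x * w = y * u - 4 * t * g"
  proof -
    have "x * w = x * T - y0 * z0 + y * u + (4 * t * (- (x ^ n * y)) + 4 * t * s * (y\<^sup>2 - x ^ e * u))"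
      unfolding w right_diff_distrib Ecoef_eq[OF ne] y0[symmetric] z0[symmetric] by simp
    then show ?thesis
      unfolding t[symmetric] xny xeu by (simp add: power2_eq_square algebra_simps)
  qed
  have xz: "x * z = u + g * (u - 4 * t * (x ^ n - s * y))"
  proof -
    have "x * z = (x ^ n - s * y) * (x * w) + s * (x * x ^ (e - 1)) * u * u"
      unfolding z by (simp add: power2_eq_square algebra_simps)
    also have "\<dots> = (x ^ n * y) * u - s * y * y * u - (x ^ n - s * y) * 4 * t * g + s * (x ^ e * u) * u"
      unfolding xw xx by (simp add: algebra_simps)
    also have "\<dots> = u + g * (u - 4 * t * (x ^ n - s * y))"
      unfolding xny xeu by (simp add: power2_eq_square algebra_simps)
    finally show ?thesis .
  qed
  (* Here y u is replaced by x w in the last summand of z; the new factor x completes x^(e-1) to x^e. *)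
  have yz: "y * z = w + g * (w + 4 * t * s * x ^ (e - 1) * u)"
  proof -
    have "y * z = (x ^ n * y) * w - s * y * y * w + s * x ^ (e - 1) * u * (y * u)"
      unfolding z by (simp add: power2_eq_square algebra_simps)
    also have "y * u = x * w + 4 * t * g"
      using xw by simp
    also have "(x ^ n * y) * w - s * y * y * w + s * x ^ (e - 1) * u * (x * w + 4 * t * g) =
        (x ^ n * y) * w - s * y * y * w + s * w * ((x * x ^ (e - 1)) * u) + 4 * t * g * s * x ^ (e - 1) * u"
      by (simp add: algebra_simps)
    also have "\<dots> = w + g * (w + 4 * t * s * x ^ (e - 1) * u)"
      unfolding xx xny xeu by (simp add: power2_eq_square algebra_simps)
    finally show ?thesis .
  qed
  have cxz: "cong_mod g (x * z) u" and cyz: "cong_mod g (y * z) w"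
    by (simp_all add: cong_mod_def xz yz)
  have sigma: "cong_mod g \<sigma> s"
  proof -
    have "\<sigma> = y\<^sup>2 - x ^ e * (x * z)"
      by (simp add: \<sigma>_def)
    moreover have "cong_mod g (y\<^sup>2 - x ^ e * (x * z)) (y\<^sup>2 - x ^ e * u)"
      by (intro cong_mod_intros cxz)
    ultimately show ?thesis
      by (simp add: xeu)
  qed
  have "cong_mod g (x ^ n * y - \<sigma>\<^sup>2 - 1) (x ^ n * y - s\<^sup>2 - 1)"
    by (intro cong_mod_intros sigma)
  then show "cong_mod g (x ^ n * y - \<sigma>\<^sup>2 - 1) 0"
    by (rule cong_mod_trans) (simp add: xny cong_mod_def)
  have "cong_mod g (y + Lcoef n e x \<sigma> t) (y + ?L)"
    by (intro cong_mod_intros cong_mod_coef sigma)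
  then show "cong_mod g (y + Lcoef n e x \<sigma> t) y0"
    by (simp add: y0)
  have "cong_mod g (x * z + Fcoef n e x \<sigma> y t) (u + ?F)"
    by (intro cong_mod_add cong_mod_coef sigma cxz cong_mod_refl)
  then show "cong_mod g (x * z + Fcoef n e x \<sigma> y t) z0"
    by (simp add: z0)
  have "cong_mod g (y * z + Ecoef n e x \<sigma> y t (x * z)) (w + Ecoef n e x s y t u)"
    by (intro cong_mod_add cong_mod_coef sigma cxz cyz cong_mod_refl)
  then show "cong_mod g (y * z + Ecoef n e x \<sigma> y t (x * z)) T"
    by (simp add: w)
qed

text \<open>
  The other composite: now \<open>(x, y, z, t)\<close> are the coordinates on \<open>R\<^sub>n\<^sub>,\<^sub>e\<^sub>+\<^sub>1[T]\<close>, index \<open>1\<close> marks the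
  images under \<open>\<phi>\<close>, and index \<open>2\<close> the images under \<open>\<phi>\<close> of the coordinates of the inverse. Each
  definition of the inverse undoes one step of \<open>\<phi>\<close>, so the values collapse to \<open>t, s, y, xz, yz, z\<close>
  one after the other.
\<close>

lemma inverse_coordinates_converse:
  fixes x :: "'a::comm_ring_1"
  assumes ne: "n \<ge> 1" "e \<ge> 1" and q: "4 * q = 1"
    and s: "s = y\<^sup>2 - x ^ (e + 1) * z" and g: "g = x ^ n * y - s\<^sup>2 - 1"
    and y1: "y1 = y + Lcoef n e x s t"
    and z1: "z1 = x * z + Fcoef n e x s y t"
    and t1: "t1 = y * z + Ecoef n e x s y t (x * z)"
    and t2: "t2 = q * (x * t1 - y1 * z1)"
    and s2: "s2 = y1\<^sup>2 - x ^ e * z1 - x ^ (n + e) * t2"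
    and y2: "y2 = y1 - Lcoef n e x s2 t2"
    and u2: "u2 = z1 - Fcoef n e x s2 y2 t2"
    and w2: "w2 = t1 - Ecoef n e x s2 y2 t2 u2"
    and z2: "z2 = x ^ n * w2 - s2 * y2 * w2 + s2 * x ^ (e - 1) * u2\<^sup>2"
  shows "x ^ n * y1 - (y1\<^sup>2 - x ^ e * z1)\<^sup>2 - 1 = g"
    and "cong_mod g t2 t" and "cong_mod g y2 y" and "cong_mod g z2 z"
proof -
  define h where "h = x ^ (n + e) * t"
  have xx: "x * x ^ (e - 1) = x ^ e"
    using ne(2) by (simp flip: power_Suc)
  have s1: "y1\<^sup>2 - x ^ e * z1 = s + h"
    unfolding y1 z1 distrib_left[of "x ^ e"] Fcoef_eq h_def s
    by (simp add: power2_eq_square algebra_simps)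
  show "x ^ n * y1 - (y1\<^sup>2 - x ^ e * z1)\<^sup>2 - 1 = g"
    unfolding s1 unfolding y1 distrib_left[of "x ^ n"] Lcoef_eq h_def[symmetric] g
    by (simp add: power2_eq_square algebra_simps)
  have "x * t1 - y1 * z1 = 4 * t * (x ^ n * y) - 4 * t * s * (y\<^sup>2 - x ^ e * (x * z))"
    unfolding t1 distrib_left[of x] Ecoef_eq[OF ne] y1[symmetric] z1[symmetric]
    by (simp add: algebra_simps)
  also have "x ^ n * y = s\<^sup>2 + 1 + g"
    by (simp add: g)
  also have "y\<^sup>2 - x ^ e * (x * z) = s"
    by (simp add: s algebra_simps)
  also have "4 * t * (s\<^sup>2 + 1 + g) - 4 * t * s * s = 4 * (t + t * g)"
    by (simp add: power2_eq_square algebra_simps)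
  finally have "t2 = (4 * q) * (t + t * g)"
    by (simp add: t2 algebra_simps)
  then show ct: "cong_mod g t2 t"
    by (simp add: q cong_mod_def)
  have "cong_mod g (s + h - x ^ (n + e) * t2) (s + h - x ^ (n + e) * t)"
    by (intro cong_mod_intros ct)
  then have cs: "cong_mod g s2 s"
    by (simp add: s2 s1 h_def)
  have "cong_mod g y2 (y1 - Lcoef n e x s t)"
    unfolding y2 by (intro cong_mod_intros cong_mod_coef cs ct)
  then show cy: "cong_mod g y2 y"
    by (simp add: y1)
  have "cong_mod g u2 (z1 - Fcoef n e x s y t)"
    unfolding u2 by (intro cong_mod_diff cong_mod_refl cong_mod_coef cs ct cy)
  then have cu: "cong_mod g u2 (x * z)"
    by (simp add: z1)
  have "cong_mod g w2 (t1 - Ecoef n e x s y t (x * z))"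
    unfolding w2 by (intro cong_mod_diff cong_mod_refl cong_mod_coef cs ct cy cu)
  then have cw: "cong_mod g w2 (y * z)"
    by (simp add: t1)
  have "cong_mod g z2 (x ^ n * (y * z) - s * y * (y * z) + s * x ^ (e - 1) * (x * z)\<^sup>2)"
    unfolding z2 by (intro cong_mod_intros cs cy cu cw)
  also have "x ^ n * (y * z) - s * y * (y * z) + s * x ^ (e - 1) * (x * z)\<^sup>2 =
      (x ^ n * y - s * (y\<^sup>2 - (x * x ^ (e - 1)) * x * z)) * z"
    by (simp add: power2_eq_square algebra_simps)
  also have "\<dots> = (x ^ n * y - s * s) * z"
    unfolding xx s by (simp add: algebra_simps)
  also have "\<dots> = z + g * z"
    by (simp add: g power2_eq_square algebra_simps)
  also have "cong_mod g (z + g * z) z"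
    by (simp add: cong_mod_def)
  finally show "cong_mod g z2 z" .
qed

text \<open>
  The candidates for the images under the inverse of \<open>T\<close>, \<open>S = Y\<^sup>2 - X\<^sup>e\<^sup>+\<^sup>1Z\<close>, \<open>Y\<close>, \<open>XZ\<close>, \<open>YZ\<close> and
  \<open>Z\<close>. Those of \<open>XZ\<close> and \<open>YZ\<close> come before that of \<open>Z\<close>, which is assembled from them so that no
  division by \<open>X\<close> occurs.
\<close>

definition psiT :: "'k::field mp" where
  "psiT = Const (1 / 4) * (pX * pT - pY * pZ)"

definition psiS :: "nat \<Rightarrow> nat \<Rightarrow> 'k::field mp" where
  "psiS n e = pY\<^sup>2 - pX ^ e * pZ - pX ^ (n + e) * psiT"

definition psiY :: "nat \<Rightarrow> nat \<Rightarrow> 'k::field mp" where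
  "psiY n e = pY - Lcoef n e pX (psiS n e) psiT"

definition psiXZ :: "nat \<Rightarrow> nat \<Rightarrow> 'k::field mp" where
  "psiXZ n e = pZ - Fcoef n e pX (psiS n e) (psiY n e) psiT"

definition psiYZ :: "nat \<Rightarrow> nat \<Rightarrow> 'k::field mp" where
  "psiYZ n e = pT - Ecoef n e pX (psiS n e) (psiY n e) psiT (psiXZ n e)"

definition psiZ :: "nat \<Rightarrow> nat \<Rightarrow> 'k::field mp" where
  "psiZ n e = pX ^ n * psiYZ n e - psiS n e * psiY n e * psiYZ n e
     + psiS n e * pX ^ (e - 1) * (psiXZ n e)\<^sup>2"

definition psi_gen :: "nat \<Rightarrow> nat \<Rightarrow> indet \<Rightarrow> 'k::field mp" where
  "psi_gen n e = Var(IY := psiY n e, IZ := psiZ n e, IT := psiT)"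

lemmas psi_defs = psiT_def psiS_def psiY_def psiXZ_def psiYZ_def psiZ_def

text \<open>
  An inverse is recorded at the level of polynomials, where it can be composed and checked by
  divisibility, instead of at the level of cosets.
\<close>

definition mutually_inverse_mod ::
  "'k::field mp \<Rightarrow> 'k mp \<Rightarrow> ('k mp \<Rightarrow> 'k mp) \<Rightarrow> ('k mp \<Rightarrow> 'k mp) \<Rightarrow> bool" where
  "mutually_inverse_mod f g \<phi> \<psi> \<longleftrightarrow>
     indets f \<subseteq> {IX, IY, IZ, IT} \<and> indets g \<subseteq> {IX, IY, IZ, IT} \<and>
     \<phi> \<in> alg_hom k4 k4 \<and> \<psi> \<in> alg_hom k4 k4 \<and> g dvd \<phi> f \<and> f dvd \<psi> g \<and>
     (\<forall>p \<in> carrier k4. f dvd \<psi> (\<phi> p) - p \<and> g dvd \<phi> (\<psi> p) - p)"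

lemma indets_phi_gen:
  assumes "indets s \<subseteq> V" "{IX, IY, IZ, IT} \<subseteq> V"
  shows "indets (phi_gen n e s v) \<subseteq> V"
  using assms by (cases v) (simp_all add: phi_gen_def indets_closed indets_coef)

lemma indets_Fpoly: "{IX, IY, IZ} \<subseteq> V \<Longrightarrow> indets (Fpoly n e) \<subseteq> V"
  unfolding Fpoly_def by (intro indets_closed) auto

text \<open>
  Both composites are substitutions, so it suffices to compare them with the identity on
  \<open>X, Y, Z, T\<close>, where the congruences are instances of the two coordinate lemmas.
\<close>

lemma phi_psi_inverse:
  assumes ne: "n \<ge> 1" "e \<ge> 1"
  shows "mutually_inverse_mod (Fpoly n e) (Fpoly n (e + 1) :: 'k::field_char_0 mp)
    (phi n e) (psubst (psi_gen n e))"
proof -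
  let ?V = "{IX, IY, IZ, IT}"
  let ?s = "pY\<^sup>2 - pX ^ (e + 1) * pZ :: 'k mp"
  let ?f = "phi_gen n e ?s" and ?g = "psi_gen n e :: indet \<Rightarrow> 'k mp"
  have four: "4 * Const (1 / 4 :: 'k) = 1"
    using Const_mult[of 4 "1 / 4 :: 'k"] by (simp add: Const_numeral)
  have s_in: "indets ?s \<subseteq> ?V"
    by (intro indets_closed) auto
  have "indets (?f v) \<subseteq> ?V" if "v \<in> ?V" for v
    using that s_in by (intro indets_phi_gen) auto
  then have phi_hom: "psubst ?f \<in> alg_hom k4 k4"
    by (rule psubst_alg_hom)
  have psi_in: "indets psiT \<subseteq> ?V" "indets (psiS n e) \<subseteq> ?V" "indets (psiY n e) \<subseteq> ?V"
    "indets (psiXZ n e) \<subseteq> ?V" "indets (psiYZ n e) \<subseteq> ?V" "indets (psiZ n e) \<subseteq> ?V"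
  proof -
    show T: "indets psiT \<subseteq> ?V"
      unfolding psiT_def by (intro indets_closed) auto
    show S: "indets (psiS n e) \<subseteq> ?V"
      unfolding psiS_def by (intro indets_closed T) auto
    show Y: "indets (psiY n e) \<subseteq> ?V"
      unfolding psiY_def by (intro indets_closed indets_coef T S) auto
    show XZ: "indets (psiXZ n e) \<subseteq> ?V"
      unfolding psiXZ_def by (intro indets_closed indets_coef T S Y) auto
    show YZ: "indets (psiYZ n e) \<subseteq> ?V"
      unfolding psiYZ_def by (intro indets_closed indets_coef T S Y XZ) auto
    show "indets (psiZ n e) \<subseteq> ?V"
      unfolding psiZ_def by (intro indets_closed indets_coef T S Y XZ YZ) auto
  qed
  then have psi_hom: "psubst ?g \<in> alg_hom k4 k4"
    by (intro psubst_alg_hom) (auto simp: psi_gen_def)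
  have "4 * psiT = pX * pT - pY * (pZ :: 'k mp)"
    using four by (simp add: psiT_def mult.assoc[symmetric])
  note inv = inverse_coordinates[OF ne this refl refl psiS_def psiY_def psiXZ_def psiYZ_def psiZ_def,
      folded Fpoly_def]
  have psi_phi: "Fpoly n e dvd psubst ?g (?f v) - Var v" if "v \<in> ?V" for v
    using that inv
    by (cases v) (auto simp: phi_gen_def psi_gen_def psubst_hom psubst_coef cong_mod_def)
  note conv = inverse_coordinates_converse[where x = pX and y = pY and z = pZ and t = pT,
      OF ne four refl refl refl refl refl refl refl refl refl refl refl, folded Fpoly_def]
  have phi_psi: "Fpoly n (e + 1) dvd psubst ?f (?g v) - Var v" if "v \<in> ?V" for v
    using that conv(2-)
    by (cases v) (auto simp: phi_gen_def psi_gen_def psi_defs psubst_hom psubst_coef cong_mod_def)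
  have "psubst ?f (Fpoly n e) = Fpoly n (e + 1)"
    using conv(1) by (simp add: Fpoly_def psubst_hom phi_gen_def)
  moreover have "Fpoly n e dvd psubst ?g (Fpoly n (e + 1))"
    using inv(1) by (simp add: Fpoly_def psubst_hom psi_gen_def cong_mod_def)
  moreover have "Fpoly n e dvd psubst ?g (psubst ?f p) - p"
    "Fpoly n (e + 1) dvd psubst ?f (psubst ?g p) - p" if "p \<in> carrier k4" for p
  proof -
    have "indets p \<subseteq> ?V"
      using that by (simp add: poly_alg_def)
    then show "Fpoly n e dvd psubst ?g (psubst ?f p) - p"
      "Fpoly n (e + 1) dvd psubst ?f (psubst ?g p) - p"
      using psubst_dvd_diff[of p ?V _ _ Var] psi_phi phi_psi
      by (simp_all only: psubst_psubst psubst_Var_id)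
  qed
  moreover have "indets (Fpoly n e) \<subseteq> ?V" "indets (Fpoly n (e + 1)) \<subseteq> ?V"
    by (rule indets_Fpoly; simp)+
  ultimately show ?thesis
    unfolding mutually_inverse_mod_def phi_eq[OF ne] using phi_hom psi_hom by (intro conjI ballI) simp_all
qed

section \<open>Algebras over a field and their quotients\<close>

text \<open>
  The last axiom makes \<open>c\<close> act as multiplication by \<open>c \<odot> \<one>\<close>, so that ideals are stable under
  scalars and quotients by ideals are again algebras.
\<close>

locale k_alg = cring A for A :: "('k::field, 'a) module" (structure) +
  assumes smult_closed [simp]: "a \<in> carrier A \<Longrightarrow> c \<odot> a \<in> carrier A"
    and smult_add: "a \<in> carrier A \<Longrightarrow> b \<in> carrier A \<Longrightarrow> c \<odot> (a \<oplus> b) = c \<odot> a \<oplus> c \<odot> b"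
    and smult_mult: "a \<in> carrier A \<Longrightarrow> b \<in> carrier A \<Longrightarrow> c \<odot> (a \<otimes> b) = (c \<odot> a) \<otimes> b"

lemma (in k_alg) smult_ideal:
  assumes "ideal I A" "a \<in> I"
  shows "c \<odot> a \<in> I"
proof -
  have a: "a \<in> carrier A"
    using ideal.Icarr[OF assms] .
  have "c \<odot> a = (c \<odot> \<one>) \<otimes> a"
    using smult_mult[of \<one> a c] a by simp
  then show ?thesis
    using ideal.I_l_closed[OF assms, of "c \<odot> \<one>"] by simp
qed

lemma alg_quot_simps [simp]:
  "carrier (alg_quot A I) = carrier (A Quot I)" "mult (alg_quot A I) = mult (A Quot I)"
  "add (alg_quot A I) = add (A Quot I)" "one (alg_quot A I) = one (A Quot I)"
  "zero (alg_quot A I) = zero (A Quot I)"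
  by (simp_all add: alg_quot_def ring.defs module.defs)

lemma ring_hom_alg_quot [simp]:
  "ring_hom (alg_quot A I) B = ring_hom (A Quot I) B" "ring_hom B (alg_quot A I) = ring_hom B (A Quot I)"
  "ring_iso (alg_quot A I) B = ring_iso (A Quot I) B"
  by (simp_all add: ring_hom_def ring_iso_def)

lemma smult_alg_quot: "c \<odot>\<^bsub>alg_quot A I\<^esub> U = (\<Union>a\<in>U. I +>\<^bsub>A\<^esub> (c \<odot>\<^bsub>A\<^esub> a))"
  by (simp add: alg_quot_def ring.defs module.defs)

lemma carrier_Quot: "carrier (A Quot I) = (+>\<^bsub>A\<^esub>) I ` carrier A"
  by (auto simp: FactRing_def A_RCOSETS_def')

lemma (in k_alg) coset_eq_iff:
  assumes "ideal I A" "a \<in> carrier A" "b \<in> carrier A"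
  shows "I +> a = I +> b \<longleftrightarrow> a \<ominus> b \<in> I"
  using quotient_eq_iff_same_a_r_cos[OF assms] by simp

lemma (in k_alg) smult_diff:
  assumes "a \<in> carrier A" "b \<in> carrier A"
  shows "c \<odot> (a \<ominus> b) = c \<odot> a \<ominus> c \<odot> b"
proof -
  have "c \<odot> (a \<ominus> b) \<oplus> c \<odot> b = c \<odot> a"
    using assms smult_add[of "a \<ominus> b" b c] by (simp add: minus_eq a_assoc l_neg)
  then show ?thesis
    using assms by (metis smult_closed minus_closed minus_eq a_assoc r_neg r_zero a_inv_closed)
qed

lemma (in k_alg) smult_coset:
  assumes I: "ideal I A" and a: "a \<in> carrier A"
  shows "c \<odot>\<^bsub>alg_quot A I\<^esub> (I +> a) = I +> (c \<odot> a)"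
proof -
  interpret ideal I A by (rule I)
  have "I +> (c \<odot> b) = I +> (c \<odot> a)" if "b \<in> I +> a" for b
  proof -
    have b: "b \<in> carrier A"
      using that a a_r_coset_subset_G[OF a_subset] by blast
    have "I +> b = I +> a"
      using a_repr_independence[OF that a] I a_subgroup by simp
    then have "b \<ominus> a \<in> I"
      using coset_eq_iff[OF I b a] by simp
    then show ?thesis
      using smult_ideal[OF I, of "b \<ominus> a" c] coset_eq_iff[OF I] a b by (simp add: smult_diff)
  qed
  moreover have "a \<in> I +> a"
    using a_rcos_self[OF a] by simp
  ultimately show ?thesis
    unfolding smult_alg_quot by blast
qed

lemma (in k_alg) coset_alg_hom:
  assumes "ideal I A"
  shows "(+>) I \<in> alg_hom A (alg_quot A I)"
  using ideal.rcos_ring_hom[OF assms] smult_coset[OF assms] by (simp add: alg_hom_def)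

text \<open>
  The record of a quotient algebra extends that of \<open>A Quot I\<close> by a scalar multiplication, a field
  that the ring axioms do not see.
\<close>

lemma cring_transfer:
  assumes "cring R" "carrier S = carrier R" "mult S = mult R" "add S = add R"
    "one S = one R" "zero S = zero R"
  shows "cring S"
proof -
  interpret R: cring R by fact
  show ?thesis
    by (intro cringI abelian_groupI comm_monoidI)
      (use R.l_neg in \<open>auto simp: assms R.a_ac R.m_ac R.r_distr\<close>)
qed

lemma (in k_alg) alg_quot_k_alg:
  assumes I: "ideal I A"
  shows "k_alg (alg_quot A I)"
proof (intro k_alg.intro k_alg_axioms.intro)
  interpret ideal I A by (rule I)
  have hom: "(I +> a) \<oplus>\<^bsub>A Quot I\<^esub> (I +> b) = I +> (a \<oplus> b)"
    "(I +> a) \<otimes>\<^bsub>A Quot I\<^esub> (I +> b) = I +> (a \<otimes> b)"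
    if "a \<in> carrier A" "b \<in> carrier A" for a b
    using that ring_hom_add[OF rcos_ring_hom] ring_hom_mult[OF rcos_ring_hom] by simp_all
  show "cring (alg_quot A I)"
    by (rule cring_transfer[OF quotient_is_cring[OF is_cring]]) simp_all
  fix c U W
  assume "U \<in> carrier (alg_quot A I)"
  then obtain a where a: "a \<in> carrier A" "U = I +> a"
    by (auto simp: carrier_Quot)
  show "c \<odot>\<^bsub>alg_quot A I\<^esub> U \<in> carrier (alg_quot A I)"
    using a by (simp add: smult_coset[OF I] carrier_Quot)
  assume "W \<in> carrier (alg_quot A I)"
  then obtain b where b: "b \<in> carrier A" "W = I +> b"
    by (auto simp: carrier_Quot)
  show "c \<odot>\<^bsub>alg_quot A I\<^esub> (U \<oplus>\<^bsub>alg_quot A I\<^esub> W) =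
      c \<odot>\<^bsub>alg_quot A I\<^esub> U \<oplus>\<^bsub>alg_quot A I\<^esub> c \<odot>\<^bsub>alg_quot A I\<^esub> W"
    using a b by (simp add: hom smult_coset[OF I] smult_add)
  show "c \<odot>\<^bsub>alg_quot A I\<^esub> (U \<otimes>\<^bsub>alg_quot A I\<^esub> W) =
      (c \<odot>\<^bsub>alg_quot A I\<^esub> U) \<otimes>\<^bsub>alg_quot A I\<^esub> W"
    using a b by (simp add: hom smult_coset[OF I] smult_mult)
qed

lemma alg_homD:
  assumes "h \<in> alg_hom A B" "a \<in> carrier A"
  shows "h a \<in> carrier B" "h (c \<odot>\<^bsub>A\<^esub> a) = c \<odot>\<^bsub>B\<^esub> h a"
    and "b \<in> carrier A \<Longrightarrow> h (a \<oplus>\<^bsub>A\<^esub> b) = h a \<oplus>\<^bsub>B\<^esub> h b"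
    and "b \<in> carrier A \<Longrightarrow> h (a \<otimes>\<^bsub>A\<^esub> b) = h a \<otimes>\<^bsub>B\<^esub> h b"
  using assms by (auto simp: alg_hom_def ring_hom_def)

lemma alg_hom_comp:
  assumes "h \<in> alg_hom A B" "g \<in> alg_hom B C"
  shows "g \<circ> h \<in> alg_hom A C"
  using assms by (auto simp: alg_hom_def ring_hom_def Pi_def)

text \<open>
  The first isomorphism theorem for algebras. The induced map \<open>g\<close> is left open, subject to its values
  on cosets; for a set-valued \<open>h\<close> it can be the union of \<open>h\<close> over a coset, and the first
  conclusion says that this union is constant.
\<close>

lemma (in k_alg) first_isomorphism:
  assumes B: "k_alg B" and h: "h \<in> alg_hom A B" and surj: "carrier B \<subseteq> h ` carrier A"
    and I: "ideal I A" and ker: "\<forall>a\<in>carrier A. h a = \<zero>\<^bsub>B\<^esub> \<longleftrightarrow> a \<in> I"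
  shows "a \<in> carrier A \<Longrightarrow> b \<in> I +> a \<Longrightarrow> h b = h a"
    and "(\<And>a. a \<in> carrier A \<Longrightarrow> g (I +> a) = h a) \<Longrightarrow> g \<in> alg_iso (alg_quot A I) B"
proof -
  interpret ideal I A by (rule I)
  interpret B: k_alg B by (rule B)
  interpret ring_hom_cring A B h
    using h by unfold_locales (simp add: alg_hom_def)
  note [simp] = alg_homD[OF h]
  have h_eq: "h a = h b \<longleftrightarrow> I +> a = I +> b" if "a \<in> carrier A" "b \<in> carrier A" for a b
  proof -
    have "h a = h b \<longleftrightarrow> h (a \<ominus> b) = \<zero>\<^bsub>B\<^esub>"
      using that B.minus_equality[of "h a" "\<ominus>\<^bsub>B\<^esub> h b"] by (auto simp: minus_eq hom_a_inv B.r_neg)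
    then show ?thesis
      using that by (simp add: ker coset_eq_iff[OF I])
  qed
  show "h b = h a" if "a \<in> carrier A" "b \<in> I +> a"
  proof -
    have "b \<in> carrier A"
      using that a_r_coset_subset_G[OF a_subset] by blast
    moreover have "I +> b = I +> a"
      using a_repr_independence[OF that(2,1) a_subgroup] by simp
    ultimately show ?thesis
      using that h_eq by simp
  qed
  assume g: "\<And>a. a \<in> carrier A \<Longrightarrow> g (I +> a) = h a"
  have hom: "(I +> a) \<oplus>\<^bsub>A Quot I\<^esub> (I +> b) = I +> (a \<oplus> b)"
    "(I +> a) \<otimes>\<^bsub>A Quot I\<^esub> (I +> b) = I +> (a \<otimes> b)"
    if "a \<in> carrier A" "b \<in> carrier A" for a b
    using that ring_hom_add[OF rcos_ring_hom] ring_hom_mult[OF rcos_ring_hom] by simp_all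
  have one: "\<one>\<^bsub>A Quot I\<^esub> = I +> \<one>"
    by (simp add: FactRing_def)
  have "g \<in> ring_hom (A Quot I) B"
    by (intro ring_hom_memI) (auto simp: carrier_Quot hom one g)
  moreover have "bij_betw g (carrier (A Quot I)) (carrier B)"
    using surj by (auto simp: bij_betw_def inj_on_def carrier_Quot g h_eq image_image)
  moreover have "g (c \<odot>\<^bsub>alg_quot A I\<^esub> U) = c \<odot>\<^bsub>B\<^esub> g U" if "U \<in> carrier (A Quot I)" for c U
    using that by (auto simp: carrier_Quot smult_coset[OF I] g)
  ultimately show "g \<in> alg_iso (alg_quot A I) B"
    by (simp add: alg_iso_def alg_hom_def ring_iso_def)
qed

lemma alg_isomorphic_trans:
  assumes "alg_isomorphic A B" "alg_isomorphic B C"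
  shows "alg_isomorphic A C"
proof -
  obtain f g where "f \<in> alg_iso A B" "g \<in> alg_iso B C"
    using assms by (auto simp: alg_isomorphic_def)
  then have "g \<circ> f \<in> alg_iso A C"
    using alg_hom_comp[of f A B g C] ring_iso_set_trans[of f A B g C] by (simp add: alg_iso_def)
  then show ?thesis
    by (auto simp: alg_isomorphic_def)
qed

lemma alg_isomorphic_sym:
  assumes "alg_isomorphic A B" "k_alg A"
  shows "alg_isomorphic B A"
proof -
  interpret A: k_alg A by fact
  obtain f where f: "f \<in> alg_iso A B"
    using assms by (auto simp: alg_isomorphic_def)
  let ?g = "inv_into (carrier A) f"
  have hom: "f \<in> alg_hom A B" and bij: "bij_betw f (carrier A) (carrier B)"
    using f by (auto simp: alg_iso_def ring_iso_def)
  have g: "?g \<in> ring_iso B A"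
    using ring_iso_set_sym[OF A.ring_axioms, of f B] f by (simp add: alg_iso_def)
  have "?g (c \<odot>\<^bsub>B\<^esub> b) = c \<odot>\<^bsub>A\<^esub> ?g b" if b: "b \<in> carrier B" for c b
  proof -
    obtain a where a: "a \<in> carrier A" "b = f a"
      using bij b by (auto simp: bij_betw_def)
    then have "c \<odot>\<^bsub>B\<^esub> b = f (c \<odot>\<^bsub>A\<^esub> a)"
      using alg_homD[OF hom] by simp
    then show ?thesis
      using a bij by (simp add: bij_betw_def inv_into_f_f)
  qed
  then have "?g \<in> alg_iso B A"
    using g by (simp add: alg_iso_def alg_hom_def ring_iso_def)
  then show ?thesis
    by (auto simp: alg_isomorphic_def)
qed

lemma poly_alg_simps [simp]:
  "p \<in> carrier (poly_alg V) \<longleftrightarrow> indets p \<subseteq> V" "mult (poly_alg V) = (*)" "add (poly_alg V) = (+)"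
  "one (poly_alg V) = 1" "zero (poly_alg V) = 0" "smult (poly_alg V) c p = Const c * p"
  by (simp_all add: poly_alg_def)

lemma poly_alg_k_alg: "k_alg (poly_alg V)"
proof (intro k_alg.intro k_alg_axioms.intro cringI abelian_groupI comm_monoidI)
  fix p :: "'a mp"
  assume "p \<in> carrier (poly_alg V)"
  then show "\<exists>q\<in>carrier (poly_alg V). q \<oplus>\<^bsub>poly_alg V\<^esub> p = \<zero>\<^bsub>poly_alg V\<^esub>"
    by (intro bexI[of _ "- p"]) simp_all
qed (simp_all add: indets_closed algebra_simps)

interpretation poly_alg: k_alg "poly_alg V" for V
  by (rule poly_alg_k_alg)

lemma poly_alg_minus:
  assumes "indets p \<subseteq> V" "indets q \<subseteq> V"
  shows "p \<ominus>\<^bsub>poly_alg V\<^esub> q = p - q"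
proof -
  have "\<ominus>\<^bsub>poly_alg V\<^esub> q = - q"
    using poly_alg.minus_equality[of V "- q" q] assms by simp
  then show ?thesis
    by (simp add: poly_alg.minus_eq)
qed

text \<open>
  The cofactor found by divisibility in the full polynomial ring may involve indeterminates outside
  \<open>V\<close>. Setting these to zero fixes \<open>f\<close> and \<open>p\<close> and moves the cofactor into \<open>k[V]\<close>.
\<close>

lemma mem_PIdl_iff:
  assumes "indets f \<subseteq> V" "indets p \<subseteq> V"
  shows "p \<in> PIdl\<^bsub>poly_alg V\<^esub> f \<longleftrightarrow> f dvd p"
proof
  assume "f dvd p"
  then obtain c where c: "p = f * c" by blast
  let ?s = "\<lambda>v. if v \<in> V then Var v else 0"
  have id: "psubst ?s q = q" if "indets q \<subseteq> V" for q :: "'a mp"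
    using psubst_cong[OF that, of ?s Var] by simp
  have "p = f * psubst ?s c"
    using c id[OF assms(1)] id[OF assms(2)] by (metis psubst_mult)
  moreover have "indets (psubst ?s c) \<subseteq> V"
    by (rule indets_psubst[OF subset_UNIV]) simp
  ultimately show "p \<in> PIdl\<^bsub>poly_alg V\<^esub> f"
    by (auto simp: cgenideal_def mult.commute)
qed (auto simp: cgenideal_def)

lemma PIdl_ideal: "indets f \<subseteq> V \<Longrightarrow> ideal (PIdl\<^bsub>poly_alg V\<^esub> f) (poly_alg V)"
  by (rule poly_alg.cgenideal_ideal) simp

lemma coset_PIdl_eq_iff:
  assumes "indets f \<subseteq> V" "indets p \<subseteq> V" "indets q \<subseteq> V"
  shows "PIdl\<^bsub>poly_alg V\<^esub> f +>\<^bsub>poly_alg V\<^esub> p = PIdl\<^bsub>poly_alg V\<^esub> f +>\<^bsub>poly_alg V\<^esub> q \<longleftrightarrow> f dvd p - q"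
  using assms poly_alg.coset_eq_iff[OF PIdl_ideal[OF assms(1)], of p q]
  by (simp add: poly_alg_minus mem_PIdl_iff indets_diff)

lemma coset_PIdl_zero_iff:
  assumes "indets f \<subseteq> V" "indets p \<subseteq> V"
  shows "PIdl\<^bsub>poly_alg V\<^esub> f +>\<^bsub>poly_alg V\<^esub> p = \<zero>\<^bsub>alg_quot (poly_alg V) (PIdl\<^bsub>poly_alg V\<^esub> f)\<^esub> \<longleftrightarrow> f dvd p"
proof -
  interpret ideal "PIdl\<^bsub>poly_alg V\<^esub> f" "poly_alg V"
    using assms(1) by (rule PIdl_ideal)
  have "\<zero>\<^bsub>alg_quot (poly_alg V) (PIdl\<^bsub>poly_alg V\<^esub> f)\<^esub> = PIdl\<^bsub>poly_alg V\<^esub> f +>\<^bsub>poly_alg V\<^esub> 0"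
    using poly_alg.a_rcos_zero[OF ideal_axioms, of 0] zero_closed by (simp add: FactRing_def)
  then show ?thesis
    using coset_PIdl_eq_iff[OF assms, of 0] by simp
qed

section \<open>Isomorphisms induced by mutually inverse endomorphisms\<close>

text \<open>
  If \<open>\<theta>\<close> maps a generator of one principal ideal into another, it maps the whole ideal there.
\<close>

lemma k4_hom_dvd:
  assumes "\<theta> \<in> alg_hom k4 k4" "indets a \<subseteq> {IX, IY, IZ, IT}" "indets p \<subseteq> {IX, IY, IZ, IT}"
    and "a dvd p" "b dvd \<theta> a"
  shows "b dvd \<theta> p"
proof -
  have "p \<in> PIdl\<^bsub>k4\<^esub> a"
    using mem_PIdl_iff assms by blast
  then obtain c where "indets c \<subseteq> {IX, IY, IZ, IT}" "p = c * a"
    by (auto simp: cgenideal_def)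
  then have "\<theta> p = \<theta> c * \<theta> a"
    using alg_homD(4)[OF assms(1), of c a] assms(2) by simp
  then show ?thesis
    using assms(5) by simp
qed

lemma k4_hom_closed: "\<theta> \<in> alg_hom k4 k4 \<Longrightarrow> indets p \<subseteq> {IX, IY, IZ, IT} \<Longrightarrow> indets (\<theta> p) \<subseteq> {IX, IY, IZ, IT}"
  using alg_homD(1)[of \<theta> k4 k4 p] by simp

lemma k4_hom_diff:
  assumes "\<theta> \<in> alg_hom k4 k4" "indets p \<subseteq> {IX, IY, IZ, IT}" "indets q \<subseteq> {IX, IY, IZ, IT}"
  shows "\<theta> (p - q) = \<theta> p - \<theta> q"
  using alg_homD(3)[OF assms(1), of "p - q" q] assms(2,3) by (simp add: indets_diff)

text \<open>
  For \<open>\<psi> \<circ> \<psi>' \<circ> \<phi>' \<circ> \<phi>\<close>, the inner pair is the identity modulo \<open>g\<close>, and \<open>\<psi>\<close> turns an error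
  divisible by \<open>g\<close> into one divisible by \<open>f\<close>; the outer pair is the identity modulo \<open>f\<close>. The other
  composite is symmetric.
\<close>

lemma mutually_inverse_mod_trans:
  assumes 1: "mutually_inverse_mod f g \<phi> \<psi>" and 2: "mutually_inverse_mod g h \<phi>' \<psi>'"
  shows "mutually_inverse_mod f h (\<phi>' \<circ> \<phi>) (\<psi> \<circ> \<psi>')"
proof -
  let ?V = "{IX, IY, IZ, IT}"
  have in_V: "indets f \<subseteq> ?V" "indets g \<subseteq> ?V" "indets h \<subseteq> ?V"
    and hom: "\<phi> \<in> alg_hom k4 k4" "\<psi> \<in> alg_hom k4 k4" "\<phi>' \<in> alg_hom k4 k4" "\<psi>' \<in> alg_hom k4 k4"
    and dvd: "g dvd \<phi> f" "f dvd \<psi> g" "h dvd \<phi>' g" "g dvd \<psi>' h"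
    and d1: "\<And>p. indets p \<subseteq> ?V \<Longrightarrow> f dvd \<psi> (\<phi> p) - p" "\<And>p. indets p \<subseteq> ?V \<Longrightarrow> g dvd \<phi> (\<psi> p) - p"
    and d2: "\<And>p. indets p \<subseteq> ?V \<Longrightarrow> g dvd \<psi>' (\<phi>' p) - p" "\<And>p. indets p \<subseteq> ?V \<Longrightarrow> h dvd \<phi>' (\<psi>' p) - p"
    using 1 2 unfolding mutually_inverse_mod_def by simp_all
  note closed = hom[THEN k4_hom_closed]
  have step: "c dvd \<theta> q - p"
    if "\<theta> \<in> alg_hom k4 k4" "indets a \<subseteq> ?V" "indets q \<subseteq> ?V" "indets q' \<subseteq> ?V"
      "c dvd \<theta> a" "a dvd q - q'" "c dvd \<theta> q' - p" for \<theta> and a c p q q' :: "'a mp"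
  proof -
    have "c dvd \<theta> (q - q')"
      by (rule k4_hom_dvd[of \<theta> a]) (use that indets_diff in \<open>blast+\<close>)
    then show ?thesis
      using that dvd_add[of c "\<theta> (q - q')" "\<theta> q' - p"] by (simp add: k4_hom_diff)
  qed
  have "f dvd \<psi> (\<psi>' (\<phi>' (\<phi> p))) - p \<and> h dvd \<phi>' (\<phi> (\<psi> (\<psi>' p))) - p"
    if p: "indets p \<subseteq> ?V" for p
  proof
    show "f dvd \<psi> (\<psi>' (\<phi>' (\<phi> p))) - p"
      by (rule step[OF hom(2) in_V(2) _ _ dvd(2) d2(1) d1(1)]; intro closed p)
    show "h dvd \<phi>' (\<phi> (\<psi> (\<psi>' p))) - p"
      by (rule step[OF hom(3) in_V(2) _ _ dvd(3) d1(2) d2(2)]; intro closed p)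
  qed
  moreover have "h dvd \<phi>' (\<phi> f)" "f dvd \<psi> (\<psi>' h)"
    using k4_hom_dvd[OF hom(3) in_V(2) closed(1)] k4_hom_dvd[OF hom(2) in_V(2) closed(4)] in_V dvd
    by blast+
  ultimately show ?thesis
    unfolding mutually_inverse_mod_def using in_V alg_hom_comp[OF hom(1,3)] alg_hom_comp[OF hom(4,2)]
    by simp
qed

lemma mutually_inverse_mod_refl:
  "indets f \<subseteq> {IX, IY, IZ, IT} \<Longrightarrow> mutually_inverse_mod f f id id"
  by (auto simp: mutually_inverse_mod_def alg_hom_def ring_hom_def)

text \<open>
  The composite of \<open>\<phi>\<close> with the quotient map modulo \<open>g\<close> is surjective because
  \<open>\<phi> (\<psi> p) \<equiv> p\<close>, and its kernel is the ideal of \<open>f\<close> because \<open>g dvd \<phi> p\<close> implies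
  \<open>f dvd \<psi> (\<phi> p)\<close>, hence \<open>f dvd p\<close>. The first isomorphism theorem applies.
\<close>

lemma mutually_inverse_mod_induces_iso:
  assumes inv: "mutually_inverse_mod f g \<phi> \<psi>"
  shows "induces_iso \<phi> f g"
proof -
  let ?V = "{IX, IY, IZ, IT}"
  let ?I = "PIdl\<^bsub>k4\<^esub> f" and ?J = "PIdl\<^bsub>k4\<^esub> g"
  have in_V: "indets f \<subseteq> ?V" "indets g \<subseteq> ?V"
    and hom: "\<phi> \<in> alg_hom k4 k4" "\<psi> \<in> alg_hom k4 k4"
    and dvd: "g dvd \<phi> f" "f dvd \<psi> g"
    and inv_dvd: "\<And>p. indets p \<subseteq> ?V \<Longrightarrow> f dvd \<psi> (\<phi> p) - p" "\<And>p. indets p \<subseteq> ?V \<Longrightarrow> g dvd \<phi> (\<psi> p) - p"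
    using inv unfolding mutually_inverse_mod_def by simp_all
  note closed = hom[THEN k4_hom_closed]
  define h where "h = (+>\<^bsub>k4\<^esub>) ?J \<circ> \<phi>"
  have J: "ideal ?J k4" and I: "ideal ?I k4"
    using in_V by (simp_all add: PIdl_ideal)
  have h: "h \<in> alg_hom k4 (alg_quot k4 ?J)"
    unfolding h_def using hom(1) poly_alg.coset_alg_hom[OF J] by (rule alg_hom_comp)
  have surj: "carrier (alg_quot k4 ?J) \<subseteq> h ` carrier k4"
  proof
    fix U
    assume "U \<in> carrier (alg_quot k4 ?J)"
    then obtain p where p: "indets p \<subseteq> ?V" "U = ?J +>\<^bsub>k4\<^esub> p"
      by (auto simp: carrier_Quot)
    then have "U = h (\<psi> p)"
      using coset_PIdl_eq_iff[OF in_V(2), of "\<phi> (\<psi> p)" p] inv_dvd(2)[of p] closed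
      by (simp add: h_def)
    then show "U \<in> h ` carrier k4"
      using closed(2) p(1) by simp
  qed
  have ker: "\<forall>p\<in>carrier k4. h p = \<zero>\<^bsub>alg_quot k4 ?J\<^esub> \<longleftrightarrow> p \<in> ?I"
  proof
    fix p :: "'a mp"
    assume "p \<in> carrier k4"
    then have p: "indets p \<subseteq> ?V"
      by simp
    have "f dvd p" if "g dvd \<phi> p"
    proof -
      have "f dvd \<psi> (\<phi> p)"
        using k4_hom_dvd[OF hom(2) in_V(2) closed(1)[OF p] that dvd(2)] .
      then have "f dvd \<psi> (\<phi> p) - (\<psi> (\<phi> p) - p)"
        using inv_dvd(1)[OF p] by (rule dvd_diff)
      then show ?thesis by simp
    qed
    moreover have "g dvd \<phi> p" if "f dvd p"
      using k4_hom_dvd[OF hom(1) in_V(1) p that dvd(1)] .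
    ultimately show "h p = \<zero>\<^bsub>alg_quot k4 ?J\<^esub> \<longleftrightarrow> p \<in> ?I"
      using coset_PIdl_zero_iff[OF in_V(2) closed(1)[OF p]] mem_PIdl_iff[OF in_V(1) p]
      by (auto simp: h_def)
  qed
  note first_iso = poly_alg.first_isomorphism[OF poly_alg.alg_quot_k_alg[OF J] h surj I ker]
  have "induced_map ?J \<phi> (?I +>\<^bsub>k4\<^esub> p) = h p" if "p \<in> carrier k4" for p
  proof -
    interpret ideal ?I k4 by (rule I)
    have "p \<in> ?I +>\<^bsub>k4\<^esub> p"
      using a_rcos_self[OF that] by simp
    moreover have "?J +>\<^bsub>k4\<^esub> \<phi> q = h p" if "q \<in> ?I +>\<^bsub>k4\<^esub> p" for q
      using first_iso(1)[OF \<open>p \<in> carrier k4\<close> that] unfolding h_def comp_apply .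
    ultimately show ?thesis
      unfolding induced_map_def by blast
  qed
  then have "induced_map ?J \<phi> \<in> alg_iso (alg_quot k4 ?I) (alg_quot k4 ?J)"
    by (rule first_iso(2))
  moreover have "\<phi> f \<in> ?J"
    using mem_PIdl_iff[OF in_V(2) closed(1)[OF in_V(1)]] dvd(1) by simp
  ultimately show ?thesis
    unfolding induces_iso_def using hom(1) by simp
qed

lemma phi_comp_inverse:
  assumes "n \<ge> 1" "e \<ge> 1"
  shows "\<exists>\<psi>. mutually_inverse_mod (Fpoly n e) (Fpoly n (e + m) :: 'k::field_char_0 mp) (phi_comp n e m) \<psi>"
proof (induction m)
  case 0
  have "mutually_inverse_mod (Fpoly n e) (Fpoly n e) id id"
    by (intro mutually_inverse_mod_refl indets_Fpoly) simp
  then show ?case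
    by (simp only: phi_comp.simps add_0_right) blast
next
  case (Suc m)
  then show ?case
    using mutually_inverse_mod_trans[OF _ phi_psi_inverse[OF assms(1), of "e + m"]] assms(2)
    by (simp only: phi_comp.simps add_Suc_right Suc_eq_plus1[symmetric] trans_le_add1) blast
qed

lemma phi_comp_induces_iso:
  assumes "n \<ge> 1" "e \<ge> 1"
  shows "induces_iso (phi_comp n e m :: 'k::field_char_0 mp \<Rightarrow> 'k mp) (Fpoly n e) (Fpoly n (e + m))"
  using phi_comp_inverse[OF assms, of m] by (elim exE) (rule mutually_inverse_mod_induces_iso)

section \<open>The algebra of formal pairs\<close>

lemma pair_alg_simps [simp]:
  "f \<in> carrier (pair_alg A B) \<longleftrightarrow> Poly_Mapping.keys f \<subseteq> carrier A \<times> carrier B"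
  "add (pair_alg A B) = (+)" "zero (pair_alg A B) = 0"
  "one (pair_alg A B) = Poly_Mapping.single (\<one>\<^bsub>A\<^esub>, \<one>\<^bsub>B\<^esub>) 1"
  by (simp_all add: pair_alg_def)

lemma lookup_smult_pair [simp]:
  "Poly_Mapping.lookup (c \<odot>\<^bsub>pair_alg A B\<^esub> f) k = c * Poly_Mapping.lookup f k"
  by (simp add: pair_alg_def map.rep_eq when_def)

lemma smult_pair:
  "c \<odot>\<^bsub>pair_alg A B\<^esub> (f + g) = c \<odot>\<^bsub>pair_alg A B\<^esub> f + c \<odot>\<^bsub>pair_alg A B\<^esub> g"
  "c \<odot>\<^bsub>pair_alg A B\<^esub> (f - g) = c \<odot>\<^bsub>pair_alg A B\<^esub> f - c \<odot>\<^bsub>pair_alg A B\<^esub> g"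
  "c \<odot>\<^bsub>pair_alg A B\<^esub> 0 = 0"
  "c \<odot>\<^bsub>pair_alg A B\<^esub> Poly_Mapping.single k d = Poly_Mapping.single k (c * d)"
  by (rule poly_mapping_eqI; simp add: lookup_add lookup_minus lookup_single when_def algebra_simps)+

text \<open>
  Written as an iterated linear extension, the product is biadditive, so that the ring axioms need
  to be checked on basis pairs only.
\<close>

lemma pair_mult_lin_ext:
  "f \<otimes>\<^bsub>pair_alg A B\<^esub> g = lin_ext (\<lambda>p c. lin_ext (\<lambda>q d.
     Poly_Mapping.single (fst p \<otimes>\<^bsub>A\<^esub> fst q, snd p \<otimes>\<^bsub>B\<^esub> snd q) (c * d)) g) f"
  by (simp add: pair_alg_def lin_ext_def)

lemma lin_ext_zero: "lin_ext (\<lambda>k c. 0) f = 0"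
  by (simp add: lin_ext_def)

lemma lin_ext_plus: "lin_ext (\<lambda>k c. h k c + h' k c) f = lin_ext h f + lin_ext h' f"
  by (simp add: lin_ext_def sum.distrib)

lemma pair_mult:
  "(f + f') \<otimes>\<^bsub>pair_alg A B\<^esub> g = f \<otimes>\<^bsub>pair_alg A B\<^esub> g + f' \<otimes>\<^bsub>pair_alg A B\<^esub> g"
  "f \<otimes>\<^bsub>pair_alg A B\<^esub> (g + g') = f \<otimes>\<^bsub>pair_alg A B\<^esub> g + f \<otimes>\<^bsub>pair_alg A B\<^esub> g'"
  "0 \<otimes>\<^bsub>pair_alg A B\<^esub> g = 0" "f \<otimes>\<^bsub>pair_alg A B\<^esub> 0 = 0"
  "Poly_Mapping.single p c \<otimes>\<^bsub>pair_alg A B\<^esub> Poly_Mapping.single q d =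
     Poly_Mapping.single (fst p \<otimes>\<^bsub>A\<^esub> fst q, snd p \<otimes>\<^bsub>B\<^esub> snd q) (c * d)"
  unfolding pair_mult_lin_ext
  by (simp_all add: lin_ext_add lin_ext_single lin_ext_zero lin_ext_plus
      distrib_right distrib_left single_add)

lemma keys_add_subset:
  "Poly_Mapping.keys f \<subseteq> C \<Longrightarrow> Poly_Mapping.keys g \<subseteq> C \<Longrightarrow> Poly_Mapping.keys (f + g) \<subseteq> C"
  using keys_add[of f g] by blast

lemma pair_alg_k_alg:
  assumes "cring A" "cring B"
  shows "k_alg (pair_alg A B :: ('k::field, ('a \<times> 'b) \<Rightarrow>\<^sub>0 'k) module)"
proof -
  interpret A: cring A by fact
  interpret B: cring B by fact
  let ?P = "pair_alg A B :: ('k, ('a \<times> 'b) \<Rightarrow>\<^sub>0 'k) module"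
  let ?C = "carrier A \<times> carrier B"
  note induct = poly_mapping_single_induct[of _ ?C]
  have closed: "Poly_Mapping.keys (f \<otimes>\<^bsub>?P\<^esub> g) \<subseteq> ?C"
    if "Poly_Mapping.keys f \<subseteq> ?C" "Poly_Mapping.keys g \<subseteq> ?C" for f g
    using that
  proof (induction f rule: induct)
    case (single p c)
    from single(2,1) show ?case
      by (induction g rule: induct) (auto simp: pair_mult keys_add_subset)
  qed (simp_all add: pair_mult keys_add_subset)
  have comm: "f \<otimes>\<^bsub>?P\<^esub> g = g \<otimes>\<^bsub>?P\<^esub> f"
    if "Poly_Mapping.keys f \<subseteq> ?C" "Poly_Mapping.keys g \<subseteq> ?C" for f g
    using that
  proof (induction f rule: induct)
    case (single p c)
    from single(2,1) show ?case
      by (induction g rule: induct) (auto simp: pair_mult A.m_comm B.m_comm mult.commute)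
  qed (simp_all add: pair_mult)
  have assoc: "(f \<otimes>\<^bsub>?P\<^esub> g) \<otimes>\<^bsub>?P\<^esub> h = f \<otimes>\<^bsub>?P\<^esub> (g \<otimes>\<^bsub>?P\<^esub> h)"
    if "Poly_Mapping.keys f \<subseteq> ?C" "Poly_Mapping.keys g \<subseteq> ?C" "Poly_Mapping.keys h \<subseteq> ?C" for f g h
    using that
  proof (induction f rule: induct)
    case (single p c)
    from single(2,1,3) show ?case
    proof (induction g rule: induct)
      case (single q d)
      from single(3,1,2) show ?case
        by (induction h rule: induct) (auto simp: pair_mult A.m_assoc B.m_assoc mult.assoc)
    qed (simp_all add: pair_mult)
  qed (simp_all add: pair_mult)
  have one: "\<one>\<^bsub>?P\<^esub> \<otimes>\<^bsub>?P\<^esub> f = f" if "Poly_Mapping.keys f \<subseteq> ?C" for f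
    using that by (induction f rule: induct) (auto simp: pair_mult)
  have smult_closed: "Poly_Mapping.keys (c \<odot>\<^bsub>?P\<^esub> f) \<subseteq> ?C" if "Poly_Mapping.keys f \<subseteq> ?C" for c f
    using that by (auto simp: in_keys_iff subset_iff)
  have smult_mult: "c \<odot>\<^bsub>?P\<^esub> (f \<otimes>\<^bsub>?P\<^esub> g) = (c \<odot>\<^bsub>?P\<^esub> f) \<otimes>\<^bsub>?P\<^esub> g"
    if "Poly_Mapping.keys f \<subseteq> ?C" "Poly_Mapping.keys g \<subseteq> ?C" for c f g
    using that
  proof (induction f rule: induct)
    case (single p a)
    from single(2,1) show ?case
      by (induction g rule: induct) (auto simp: pair_mult smult_pair mult.assoc)
  qed (simp_all add: pair_mult smult_pair)
  show ?thesis
  proof (intro k_alg.intro k_alg_axioms.intro cringI abelian_groupI comm_monoidI)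
    fix f
    assume "f \<in> carrier ?P"
    then show "\<exists>g\<in>carrier ?P. g \<oplus>\<^bsub>?P\<^esub> f = \<zero>\<^bsub>?P\<^esub>"
      by (intro bexI[of _ "- f"]) (auto simp: in_keys_iff)
  next
    fix f g
    assume "f \<in> carrier ?P" "g \<in> carrier ?P"
    then show "f \<otimes>\<^bsub>?P\<^esub> g = g \<otimes>\<^bsub>?P\<^esub> f"
      by (simp add: comm[of f g])
  qed (use one in \<open>simp_all add: keys_add_subset closed assoc smult_closed smult_mult smult_pair
      pair_mult add.assoc add.commute\<close>)
qed

section \<open>Tensor product with a polynomial ring in one indeterminate\<close>

definition restrict_mono :: "indet set \<Rightarrow> (indet \<Rightarrow>\<^sub>0 nat) \<Rightarrow> (indet \<Rightarrow>\<^sub>0 nat)" where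
  "restrict_mono V m = (\<Sum>v\<in>V. Poly_Mapping.single v (Poly_Mapping.lookup m v))"

lemma lookup_restrict_mono:
  "Poly_Mapping.lookup (restrict_mono V m) v = (if v \<in> V then Poly_Mapping.lookup m v else 0)"
  by (simp add: restrict_mono_def lookup_sum lookup_single when_def)

lemma keys_restrict_mono: "Poly_Mapping.keys (restrict_mono V m) \<subseteq> V"
  by (auto simp: in_keys_iff lookup_restrict_mono split: if_splits)

lemma indets_single: "Poly_Mapping.keys m \<subseteq> V \<Longrightarrow> indets (Poly_Mapping.single m c) \<subseteq> V"
  by (auto simp: indets_def keys_single)

lemma single_eq_Const_mult: "Poly_Mapping.single m c = Const c * Poly_Mapping.single m 1"
  by (simp add: Const_def mult_single)

lemma indets_iff: "indets p \<subseteq> V \<longleftrightarrow> Poly_Mapping.keys p \<subseteq> {m. Poly_Mapping.keys m \<subseteq> V}"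
  by (auto simp: indets_def)

lemma keys_diff_subset:
  assumes "Poly_Mapping.keys g \<subseteq> C" "Poly_Mapping.keys h \<subseteq> C"
  shows "Poly_Mapping.keys (g - h) \<subseteq> C"
proof
  fix k
  assume "k \<in> Poly_Mapping.keys (g - h)"
  then have "Poly_Mapping.lookup g k \<noteq> 0 \<or> Poly_Mapping.lookup h k \<noteq> 0"
    by (auto simp: in_keys_iff lookup_minus)
  then show "k \<in> C"
    using assms by (auto simp: in_keys_iff subset_iff)
qed

text \<open>
  Inside the locale, \<open>R = k[V]/\<langle>f\<rangle>\<close>, the tensor product \<open>R \<otimes> k[w]\<close> is \<open>P / K\<close>, and
  \<open>Q = k[V,w]/\<langle>f\<rangle>\<close>. The class of a polynomial in \<open>R\<close> is \<open>cls p\<close>, that in \<open>Q\<close> is \<open>Qcls p\<close>.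
\<close>

locale adjoin_indet =
  fixes V :: "indet set" and w :: indet and f :: "'k::field mp"
  assumes w: "w \<notin> V" and f: "indets f \<subseteq> V"
begin

abbreviation "R \<equiv> alg_quot (poly_alg V) (PIdl\<^bsub>poly_alg V\<^esub> f)"
abbreviation "P \<equiv> pair_alg R (poly_alg {w})"
abbreviation "K \<equiv> Idl\<^bsub>P\<^esub> (tensor_relations R (poly_alg {w}))"
abbreviation "Q \<equiv> alg_quot (poly_alg (insert w V)) (PIdl\<^bsub>poly_alg (insert w V)\<^esub> f)"
abbreviation "cls p \<equiv> PIdl\<^bsub>poly_alg V\<^esub> f +>\<^bsub>poly_alg V\<^esub> p"
abbreviation "Qcls p \<equiv> PIdl\<^bsub>poly_alg (insert w V)\<^esub> f +>\<^bsub>poly_alg (insert w V)\<^esub> p"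

definition tensor_eq :: "('k mp set \<times> 'k mp \<Rightarrow>\<^sub>0 'k) \<Rightarrow> ('k mp set \<times> 'k mp \<Rightarrow>\<^sub>0 'k) \<Rightarrow> bool" where
  "tensor_eq u v \<longleftrightarrow> u - v \<in> K"

text \<open>
  A linear section of multiplication: each monomial \<open>m m'\<close> with \<open>m\<close> in \<open>V\<close> and \<open>m'\<close> a power of \<open>w\<close>
  goes to the pair of the class of \<open>m\<close> and \<open>m'\<close>. Being linear on the nose, it allows computations
  modulo \<open>K\<close> without any choice of representatives.
\<close>

definition monomialwise :: "'k mp \<Rightarrow> ('k mp set \<times> 'k mp \<Rightarrow>\<^sub>0 'k)" where
  "monomialwise = lin_ext (\<lambda>m c. Poly_Mapping.single
     (cls (Poly_Mapping.single (restrict_mono V m) 1), Poly_Mapping.single (restrict_mono {w} m) 1) c)"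

definition rep :: "'k mp set \<Rightarrow> 'k mp" where
  "rep U = (SOME p. p \<in> U)"

text \<open>
  The map \<open>U \<otimes> b \<mapsto> U b\<close>, with an arbitrary representative of \<open>U\<close>; the choice disappears modulo \<open>f\<close>.
\<close>

definition multiply_out :: "('k mp set \<times> 'k mp \<Rightarrow>\<^sub>0 'k) \<Rightarrow> 'k mp" where
  "multiply_out = lin_ext (\<lambda>(U, b) c. Const c * rep U * b)"

lemma f_insert: "indets f \<subseteq> insert w V"
  using f by blast

lemma ideal_V: "ideal (PIdl\<^bsub>poly_alg V\<^esub> f) (poly_alg V)"
  and ideal_insert: "ideal (PIdl\<^bsub>poly_alg (insert w V)\<^esub> f) (poly_alg (insert w V))"
  by (rule PIdl_ideal[OF f], rule PIdl_ideal[OF f_insert])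

sublocale R: k_alg R
  by (rule poly_alg.alg_quot_k_alg[OF ideal_V])

sublocale Q: k_alg Q
  by (rule poly_alg.alg_quot_k_alg[OF ideal_insert])

sublocale P: k_alg P
  by (rule pair_alg_k_alg[OF R.is_cring poly_alg.is_cring])

lemma R_carrier: "U \<in> carrier R \<longleftrightarrow> (\<exists>p. indets p \<subseteq> V \<and> U = cls p)"
  unfolding alg_quot_simps carrier_Quot image_iff by (simp add: Bex_def)

lemma R_simps:
  assumes "indets p \<subseteq> V" "indets q \<subseteq> V"
  shows "cls p \<oplus>\<^bsub>R\<^esub> cls q = cls (p + q)" "cls p \<otimes>\<^bsub>R\<^esub> cls q = cls (p * q)"
    "c \<odot>\<^bsub>R\<^esub> cls p = cls (Const c * p)"
  using assms alg_homD[OF poly_alg.coset_alg_hom[OF ideal_V], of p] by simp_all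

lemma Q_simps:
  assumes "indets p \<subseteq> insert w V" "indets q \<subseteq> insert w V"
  shows "Qcls p \<oplus>\<^bsub>Q\<^esub> Qcls q = Qcls (p + q)" "Qcls p \<otimes>\<^bsub>Q\<^esub> Qcls q = Qcls (p * q)"
    "c \<odot>\<^bsub>Q\<^esub> Qcls p = Qcls (Const c * p)"
  using assms alg_homD[OF poly_alg.coset_alg_hom[OF ideal_insert], of p] by simp_all

lemma rep_coset:
  assumes "indets p \<subseteq> V"
  shows "indets (rep (cls p)) \<subseteq> V" "f dvd rep (cls p) - p" "cls (rep (cls p)) = cls p"
proof -
  interpret ideal "PIdl\<^bsub>poly_alg V\<^esub> f" "poly_alg V" by (rule ideal_V)
  have "p \<in> cls p"
    using a_rcos_self[of p] assms by simp
  then have mem: "rep (cls p) \<in> cls p"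
    unfolding rep_def by (rule someI)
  then show in_V: "indets (rep (cls p)) \<subseteq> V"
    using subsetD[OF poly_alg.a_r_coset_subset_G[OF a_subset, of p] mem] assms by simp
  show eq: "cls (rep (cls p)) = cls p"
    using poly_alg.a_repr_independence[OF mem _ a_subgroup] assms by simp
  then show "f dvd rep (cls p) - p"
    using coset_PIdl_eq_iff[OF f in_V assms] by simp
qed

lemma restrict_mono_split:
  assumes "Poly_Mapping.keys m \<subseteq> insert w V"
  shows "restrict_mono V m + restrict_mono {w} m = m"
  using assms w by (auto intro!: poly_mapping_eqI simp: lookup_restrict_mono lookup_add
      in_keys_iff subset_iff)

lemma relations_closed: "tensor_relations R (poly_alg {w}) \<subseteq> carrier P"
proof -
  have diff: "u - v \<in> carrier P" if "u \<in> carrier P" "v \<in> carrier P" for u v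
    using that by (simp add: keys_diff_subset)
  have single: "Poly_Mapping.single (a, b) c \<in> carrier P"
    if "a \<in> carrier R" "b \<in> carrier (poly_alg {w})" for a b c
    using that by (simp add: keys_single)
  note [simp del] = alg_quot_simps poly_alg_simps pair_alg_simps
  show ?thesis
    unfolding tensor_relations_def by (auto intro!: diff single)
qed

lemma ideal_K: "ideal K P"
  by (rule P.genideal_ideal[OF relations_closed])

lemma relation_tensor_eq: "u - v \<in> tensor_relations R (poly_alg {w}) \<Longrightarrow> tensor_eq u v"
  unfolding tensor_eq_def using P.genideal_self[OF relations_closed] by blast

lemma K_add: "u \<in> K \<Longrightarrow> v \<in> K \<Longrightarrow> u + v \<in> K"
  using additive_subgroup.a_closed[OF ideal.axioms(1)[OF ideal_K]] by simp

lemma tensor_eq_refl [simp]: "tensor_eq u u"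
  using additive_subgroup.zero_closed[OF ideal.axioms(1)[OF ideal_K]] by (simp add: tensor_eq_def)

lemma tensor_eq_trans [trans]: "tensor_eq u v \<Longrightarrow> tensor_eq v x \<Longrightarrow> tensor_eq u x"
  using K_add[of "u - v" "v - x"] by (simp add: tensor_eq_def)

lemma tensor_eq_add: "tensor_eq u v \<Longrightarrow> tensor_eq u' v' \<Longrightarrow> tensor_eq (u + u') (v + v')"
  using K_add[of "u - v" "u' - v'"] by (simp add: tensor_eq_def algebra_simps)

lemma tensor_eq_scale: "tensor_eq u v \<Longrightarrow> tensor_eq (c \<odot>\<^bsub>P\<^esub> u) (c \<odot>\<^bsub>P\<^esub> v)"
  using P.smult_ideal[OF ideal_K, of "u - v" c] by (simp add: tensor_eq_def smult_pair)

lemma tensor_eq_sym: "tensor_eq u v \<Longrightarrow> tensor_eq v u"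
proof -
  assume "tensor_eq u v"
  then have "(- 1) \<odot>\<^bsub>P\<^esub> (u - v) \<in> K"
    using P.smult_ideal[OF ideal_K] by (simp add: tensor_eq_def)
  moreover have "(- 1) \<odot>\<^bsub>P\<^esub> (u - v) = v - u"
    by (rule poly_mapping_eqI) (simp add: lookup_minus)
  ultimately show ?thesis
    by (simp add: tensor_eq_def)
qed

lemma tensor_eq_bilinear:
  assumes p: "indets p \<subseteq> V" and q: "indets q \<subseteq> V" and b: "indets b \<subseteq> {w}" and b': "indets b' \<subseteq> {w}"
  shows "tensor_eq (Poly_Mapping.single (cls (p + q), b) 1)
      (Poly_Mapping.single (cls p, b) 1 + Poly_Mapping.single (cls q, b) 1)"
    and "tensor_eq (Poly_Mapping.single (cls p, b + b') 1)
      (Poly_Mapping.single (cls p, b) 1 + Poly_Mapping.single (cls p, b') 1)"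
    and "tensor_eq (Poly_Mapping.single (cls (Const c * p), b) 1) (Poly_Mapping.single (cls p, b) c)"
    and "tensor_eq (Poly_Mapping.single (cls p, Const c * b) 1) (Poly_Mapping.single (cls p, b) c)"
proof -
  have R: "cls p \<in> carrier R" "cls q \<in> carrier R"
    using p q R_carrier by blast+
  have B: "b \<in> carrier (poly_alg {w})" "b' \<in> carrier (poly_alg {w})"
    using b b' by simp_all
  show "tensor_eq (Poly_Mapping.single (cls (p + q), b) 1)
      (Poly_Mapping.single (cls p, b) 1 + Poly_Mapping.single (cls q, b) 1)"
    unfolding R_simps(1)[OF p q, symmetric]
    by (rule relation_tensor_eq) (use R B in \<open>unfold tensor_relations_def diff_diff_eq[symmetric], blast\<close>)
  show "tensor_eq (Poly_Mapping.single (cls p, b + b') 1)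
      (Poly_Mapping.single (cls p, b) 1 + Poly_Mapping.single (cls p, b') 1)"
    unfolding poly_alg_simps(3)[of "{w}", symmetric]
    by (rule relation_tensor_eq) (use R B in \<open>unfold tensor_relations_def diff_diff_eq[symmetric], blast\<close>)
  show "tensor_eq (Poly_Mapping.single (cls (Const c * p), b) 1) (Poly_Mapping.single (cls p, b) c)"
    unfolding R_simps(3)[OF p p, symmetric]
    by (rule relation_tensor_eq) (use R B in \<open>unfold tensor_relations_def, blast\<close>)
  show "tensor_eq (Poly_Mapping.single (cls p, Const c * b) 1) (Poly_Mapping.single (cls p, b) c)"
    unfolding poly_alg_simps(6)[of "{w}", symmetric]
    by (rule relation_tensor_eq) (use R B in \<open>unfold tensor_relations_def, blast\<close>)
qed

lemma monomialwise_add: "monomialwise (p + q) = monomialwise p + monomialwise q"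
  and monomialwise_0 [simp]: "monomialwise 0 = 0"
  and monomialwise_single: "monomialwise (Poly_Mapping.single m c) = Poly_Mapping.single
     (cls (Poly_Mapping.single (restrict_mono V m) 1), Poly_Mapping.single (restrict_mono {w} m) 1) c"
  by (simp_all add: monomialwise_def lin_ext_add lin_ext_single single_add)

lemma monomialwise_scale: "monomialwise (Const c * p) = c \<odot>\<^bsub>P\<^esub> monomialwise p"
proof (induction p rule: poly_mapping_single_induct[OF subset_UNIV])
  case (2 m d)
  have "Const c * Poly_Mapping.single m d = Poly_Mapping.single m (c * d)"
    by (simp add: Const_def mult_single)
  then show ?case
    by (simp add: monomialwise_single smult_pair)
qed (simp_all add: monomialwise_add smult_pair distrib_left)

lemma monomialwise_closed:
  "indets p \<subseteq> insert w V \<Longrightarrow> monomialwise p \<in> carrier P"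
  unfolding indets_iff
proof (induction p rule: poly_mapping_single_induct)
  case (single m c)
  have "cls (Poly_Mapping.single (restrict_mono V m) 1) \<in> carrier R"
    unfolding R_carrier using indets_single[OF keys_restrict_mono] by blast
  then show ?case
    by (simp add: monomialwise_single keys_single indets_single keys_restrict_mono)
next
  case (add p q)
  then show ?case
    by (simp add: monomialwise_add keys_add_subset)
qed simp

lemma tensor_eq_zero:
  assumes "indets p \<subseteq> V" "indets b \<subseteq> {w}"
  shows "tensor_eq (Poly_Mapping.single (cls 0, b) 1) 0" "tensor_eq (Poly_Mapping.single (cls p, 0) 1) 0"
  using tensor_eq_bilinear(3,4)[OF assms(1,1,2,2), of 0] by simp_all

text \<open>
  Both sides are bilinear in \<open>p\<close> and \<open>b\<close> modulo the relations, and they agree when \<open>p\<close> and \<open>b\<close> are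
  monomials.
\<close>

lemma tensor_eq_monomialwise:
  assumes "indets p \<subseteq> V" "indets b \<subseteq> {w}"
  shows "tensor_eq (Poly_Mapping.single (cls p, b) 1) (monomialwise (p * b))"
proof -
  have scale: "Poly_Mapping.single x c = c \<odot>\<^bsub>P\<^esub> Poly_Mapping.single x 1" for x c
    by (simp add: smult_pair)
  have mono: "tensor_eq (Poly_Mapping.single (cls (Poly_Mapping.single m 1), b) 1)
      (monomialwise (Poly_Mapping.single m 1 * b))"
    if m: "Poly_Mapping.keys m \<subseteq> V" and "indets b \<subseteq> {w}" for m b
    using that(2) unfolding indets_iff
  proof (induction b rule: poly_mapping_single_induct)
    case zero
    then show ?case
      using tensor_eq_zero[OF indets_single[OF m], of 0] by simp
  next
    case (single k c)
    then have k: "indets (Poly_Mapping.single k 1) \<subseteq> {w}"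
      by (simp add: indets_single)
    have "restrict_mono V (m + k) = m" "restrict_mono {w} (m + k) = k"
      using m single w by (auto intro!: poly_mapping_eqI simp: lookup_restrict_mono lookup_add
          in_keys_iff subset_iff)
    then have "monomialwise (Poly_Mapping.single m 1 * Poly_Mapping.single k c) =
        Poly_Mapping.single (cls (Poly_Mapping.single m 1), Poly_Mapping.single k 1) c"
      by (simp add: mult_single monomialwise_single)
    then show ?case
      using tensor_eq_bilinear(4)[OF indets_single[OF m] indets_single[OF m] k k, of 1 c]
      by (simp flip: single_eq_Const_mult)
  next
    case (add b b')
    then have "indets b \<subseteq> {w}" "indets b' \<subseteq> {w}"
      by (simp_all add: indets_iff)
    from tensor_eq_trans[OF tensor_eq_bilinear(2)[OF indets_single[OF m] indets_single[OF m] this]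
        tensor_eq_add[OF add(3,4)]]
    show ?case
      by (simp add: monomialwise_add distrib_left)
  qed
  show ?thesis
    using assms(1) unfolding indets_iff
  proof (induction p rule: poly_mapping_single_induct)
    case zero
    then show ?case
      using tensor_eq_zero[OF _ assms(2), of 0] by simp
  next
    case (single m c)
    then have m: "indets (Poly_Mapping.single m 1) \<subseteq> V"
      by (simp add: indets_single)
    have "tensor_eq (Poly_Mapping.single (cls (Poly_Mapping.single m c), b) 1)
        (Poly_Mapping.single (cls (Poly_Mapping.single m 1), b) c)"
      using tensor_eq_bilinear(3)[OF m m assms(2,2), of c] by (simp flip: single_eq_Const_mult)
    also have "tensor_eq \<dots> (c \<odot>\<^bsub>P\<^esub> monomialwise (Poly_Mapping.single m 1 * b))"
      using tensor_eq_scale[OF mono[OF _ assms(2)], of m c] single by (simp add: smult_pair)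
    also have "\<dots> = monomialwise (Poly_Mapping.single m c * b)"
      by (subst single_eq_Const_mult[of m c]) (simp only: monomialwise_scale mult.assoc)
    finally show ?case .
  next
    case (add p q)
    then have "indets p \<subseteq> V" "indets q \<subseteq> V"
      by (simp_all add: indets_iff)
    from tensor_eq_trans[OF tensor_eq_bilinear(1)[OF this assms(2,2)] tensor_eq_add[OF add(3,4)]]
    show ?case
      by (simp add: monomialwise_add distrib_right)
  qed
qed

text \<open>
  By linearity \<open>q\<close> is a monomial \<open>m m'\<close> with \<open>m\<close> in \<open>V\<close> and \<open>m'\<close> a power of \<open>w\<close>, up to a scalar. Then
  \<open>f q\<close> is the product of \<open>f m\<close>, whose class in \<open>R\<close> vanishes, and \<open>m'\<close>.
\<close>

lemma monomialwise_multiple: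
  assumes "indets q \<subseteq> insert w V"
  shows "tensor_eq (monomialwise (f * q)) 0"
  using assms unfolding indets_iff
proof (induction q rule: poly_mapping_single_induct)
  case (single m c)
  let ?p = "f * Poly_Mapping.single (restrict_mono V m) c"
  let ?b = "Poly_Mapping.single (restrict_mono {w} m) 1"
  have "restrict_mono V m + restrict_mono {w} m = m"
    using single restrict_mono_split by simp
  then have "f * Poly_Mapping.single m c = ?p * ?b"
    by (simp add: mult.assoc mult_single)
  moreover have p: "indets ?p \<subseteq> V" and b: "indets ?b \<subseteq> {w}"
    by (simp_all add: indets_mult f indets_single keys_restrict_mono)
  moreover have "cls ?p = cls 0"
    using coset_PIdl_eq_iff[OF f p, of 0] by simp
  ultimately show ?case
    using tensor_eq_trans[OF tensor_eq_sym[OF tensor_eq_monomialwise[OF p b]]] tensor_eq_zero(1)[OF p b]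
    by simp
next
  case (add p q)
  then show ?case
    using tensor_eq_add[OF add(3,4)] by (simp add: distrib_left monomialwise_add)
qed simp

lemma multiply_out_add: "multiply_out (g + h) = multiply_out g + multiply_out h"
  and multiply_out_0 [simp]: "multiply_out 0 = 0"
  and multiply_out_single: "multiply_out (Poly_Mapping.single (U, b) c) = Const c * rep U * b"
  by (simp_all add: multiply_out_def lin_ext_add lin_ext_single case_prod_beta Const_add distrib_right)

lemma multiply_out_diff: "multiply_out (g - h) = multiply_out g - multiply_out h"
  using multiply_out_add[of "g - h" h] by simp

text \<open>
  A formal pair can be rebuilt modulo the relations from its product. Hence an element whose product
  is a multiple of \<open>f\<close> lies in \<open>K\<close>, by \<open>monomialwise_multiple\<close>.
\<close>

lemma tensor_eq_multiply_out:
  "g \<in> carrier P \<Longrightarrow> tensor_eq g (monomialwise (multiply_out g))"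
  unfolding pair_alg_simps(1)
proof (induction g rule: poly_mapping_single_induct)
  case (single k c)
  obtain U b where k: "k = (U, b)" and "U \<in> carrier R" and b: "indets b \<subseteq> {w}"
    using single by (auto simp del: alg_quot_simps)
  then obtain p where p: "indets p \<subseteq> V" "U = cls p"
    using R_carrier by blast
  have "tensor_eq (c \<odot>\<^bsub>P\<^esub> Poly_Mapping.single k 1) (c \<odot>\<^bsub>P\<^esub> monomialwise (rep U * b))"
    using tensor_eq_scale[OF tensor_eq_monomialwise[OF rep_coset(1)[OF p(1)] b], of c]
    by (simp add: k p rep_coset(3))
  then show ?case
    by (simp add: k multiply_out_single smult_pair mult.assoc monomialwise_scale)
next
  case (add g h)
  then show ?case
    using tensor_eq_add[OF add(3,4)] by (simp add: multiply_out_add monomialwise_add)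
qed simp

lemma multiply_out_closed: "g \<in> carrier P \<Longrightarrow> indets (multiply_out g) \<subseteq> insert w V"
  unfolding pair_alg_simps(1)
proof (induction g rule: poly_mapping_single_induct)
  case (single k c)
  obtain U b where k: "k = (U, b)" and "U \<in> carrier R" and b: "indets b \<subseteq> {w}"
    using single by (auto simp del: alg_quot_simps)
  then obtain p where p: "indets p \<subseteq> V" "U = cls p"
    using R_carrier by blast
  have "indets (rep U) \<subseteq> insert w V" "indets b \<subseteq> insert w V"
    using rep_coset(1)[OF p(1)] p(2) b by blast+
  then show ?case
    by (simp add: k multiply_out_single indets_mult)
qed (simp_all add: multiply_out_add indets_add)

lemma multiply_out_scale: "multiply_out (c \<odot>\<^bsub>P\<^esub> g) = Const c * multiply_out g"
proof (induction g rule: poly_mapping_single_induct[OF subset_UNIV])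
  case (2 k d)
  obtain U b where "k = (U, b)"
    by fastforce
  then show ?case
    by (simp add: smult_pair multiply_out_single Const_mult mult.assoc)
qed (simp_all add: smult_pair multiply_out_add distrib_left)

lemma multiply_out_mult:
  assumes "g \<in> carrier P" "h \<in> carrier P"
  shows "f dvd multiply_out (g \<otimes>\<^bsub>P\<^esub> h) - multiply_out g * multiply_out h"
  using assms unfolding pair_alg_simps(1)
proof (induction g rule: poly_mapping_single_induct)
  case (single k c)
  from single(2,1) show ?case
  proof (induction h rule: poly_mapping_single_induct)
    case (single l d)
    obtain U b where k1: "k = (U, b)" "U \<in> carrier R"
      using single(2) by (rule SigmaE)
    obtain U' b' where k2: "l = (U', b')" "U' \<in> carrier R"
      using single(1) by (rule SigmaE)
    note k = k1(1) k2(1)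
    obtain p where p: "indets p \<subseteq> V" "U = cls p"
      using k1(2) R_carrier by blast
    obtain q where q: "indets q \<subseteq> V" "U' = cls q"
      using k2(2) R_carrier by blast
    note in_V = rep_coset(1)[OF p(1)] rep_coset(1)[OF q(1)]
    have rep_UU': "U \<otimes>\<^bsub>R\<^esub> U' = cls (rep U * rep U')"
      using R_simps(2)[OF in_V] unfolding p(2) q(2) rep_coset(3)[OF p(1)] rep_coset(3)[OF q(1)] .
    have "f dvd rep (U \<otimes>\<^bsub>R\<^esub> U') - rep U * rep U'"
      unfolding rep_UU' by (rule rep_coset(2)[OF indets_mult]) (use in_V p(2) q(2) in blast)+
    then have "f dvd (Const c * Const d * b * b') * (rep (U \<otimes>\<^bsub>R\<^esub> U') - rep U * rep U')"
      by (rule dvd_mult)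
    moreover have "multiply_out (Poly_Mapping.single k c \<otimes>\<^bsub>P\<^esub> Poly_Mapping.single l d)
        - multiply_out (Poly_Mapping.single k c) * multiply_out (Poly_Mapping.single l d) =
        (Const c * Const d * b * b') * (rep (U \<otimes>\<^bsub>R\<^esub> U') - rep U * rep U')"
      unfolding k pair_mult multiply_out_single fst_conv snd_conv poly_alg_simps(2) Const_mult
      by (simp only: algebra_simps)
    ultimately show ?case
      by (simp only:)
  next
    case (add h h')
    have "f dvd (multiply_out (Poly_Mapping.single k c \<otimes>\<^bsub>P\<^esub> h) - multiply_out (Poly_Mapping.single k c) * multiply_out h)
        + (multiply_out (Poly_Mapping.single k c \<otimes>\<^bsub>P\<^esub> h') - multiply_out (Poly_Mapping.single k c) * multiply_out h')"
      using add(3)[OF add(5)] add(4)[OF add(5)] by (rule dvd_add)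
    then show ?case
      by (simp add: pair_mult multiply_out_add algebra_simps)
  qed (simp_all add: pair_mult)
next
  case (add g g')
  have "f dvd (multiply_out (g \<otimes>\<^bsub>P\<^esub> h) - multiply_out g * multiply_out h)
      + (multiply_out (g' \<otimes>\<^bsub>P\<^esub> h) - multiply_out g' * multiply_out h)"
    using add(3)[OF add(5)] add(4)[OF add(5)] by (rule dvd_add)
  then show ?case
    by (simp add: pair_mult multiply_out_add algebra_simps)
qed (simp_all add: pair_mult)

lemma multiply_out_monomialwise:
  assumes "indets p \<subseteq> insert w V"
  shows "f dvd multiply_out (monomialwise p) - p"
  using assms unfolding indets_iff
proof (induction p rule: poly_mapping_single_induct)
  case (single m c)
  let ?v = "Poly_Mapping.single (restrict_mono V m) 1"
  let ?b = "Poly_Mapping.single (restrict_mono {w} m) 1"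
  have "restrict_mono V m + restrict_mono {w} m = m"
    using single restrict_mono_split by simp
  then have "Poly_Mapping.single m c = Const c * ?b * ?v"
    by (simp add: mult_single Const_def add.commute)
  then have "multiply_out (monomialwise (Poly_Mapping.single m c)) - Poly_Mapping.single m c =
      (Const c * ?b) * (rep (cls ?v) - ?v)"
    unfolding monomialwise_single multiply_out_single by (simp only: algebra_simps)
  moreover have "f dvd (Const c * ?b) * (rep (cls ?v) - ?v)"
    by (intro dvd_mult rep_coset(2) indets_single keys_restrict_mono)
  ultimately show ?case
    by simp
next
  case (add p q)
  then show ?case
    using dvd_add[OF add(3,4)] by (simp add: monomialwise_add multiply_out_add algebra_simps)
qed simp

lemma multiply_out_relations:
  assumes "r \<in> tensor_relations R (poly_alg {w})"
  shows "f dvd multiply_out r"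
proof -
  note [simp del] = alg_quot_simps
  have rep: "indets (rep U) \<subseteq> V" "cls (rep U) = U" if "U \<in> carrier R" for U
    using that rep_coset R_carrier by auto
  have add: "f dvd rep (U \<oplus>\<^bsub>R\<^esub> U') - rep U - rep U'" if "U \<in> carrier R" "U' \<in> carrier R" for U U'
    using rep_coset(2)[of "rep U + rep U'"] R_simps(1)[of "rep U" "rep U'"] rep that
    by (simp add: indets_add diff_diff_eq)
  have smult: "f dvd rep (c \<odot>\<^bsub>R\<^esub> U) - Const c * rep U" if "U \<in> carrier R" for U c
    using rep_coset(2)[of "Const c * rep U"] R_simps(3)[of "rep U" "rep U" c] rep that
    by (simp add: indets_mult)
  have out_add: "f dvd multiply_out (Poly_Mapping.single (U \<oplus>\<^bsub>R\<^esub> U', b) 1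
      - Poly_Mapping.single (U, b) 1 - Poly_Mapping.single (U', b) 1)"
    if "U \<in> carrier R" "U' \<in> carrier R" for U U' b
    using dvd_mult2[OF add[OF that], of b] by (simp add: multiply_out_diff multiply_out_single left_diff_distrib)
  have out_smult: "f dvd multiply_out (Poly_Mapping.single (c \<odot>\<^bsub>R\<^esub> U, b) 1 - Poly_Mapping.single (U, b) c)"
    if "U \<in> carrier R" for U b c
    using dvd_mult2[OF smult[OF that], of c b] by (simp add: multiply_out_diff multiply_out_single left_diff_distrib)
  have "multiply_out (Poly_Mapping.single (U, b + b') 1 - Poly_Mapping.single (U, b) 1 - Poly_Mapping.single (U, b') 1) = 0"
    "multiply_out (Poly_Mapping.single (U, Const c * b) 1 - Poly_Mapping.single (U, b) c) = 0" for U b b' c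
    by (simp_all add: multiply_out_diff multiply_out_single distrib_left mult.assoc mult.left_commute)
  with assms show ?thesis
    unfolding tensor_relations_def by (auto intro: out_add out_smult)
qed

definition to_quot :: "('k mp set \<times> 'k mp \<Rightarrow>\<^sub>0 'k) \<Rightarrow> 'k mp set" where
  "to_quot g = Qcls (multiply_out g)"

lemma to_quot_alg_hom: "to_quot \<in> alg_hom P Q"
proof -
  have "to_quot \<in> ring_hom P Q"
  proof (rule ring_hom_memI)
    fix g h
    assume g: "g \<in> carrier P" and h: "h \<in> carrier P"
    note in_V = multiply_out_closed[OF g] multiply_out_closed[OF h]
    show "to_quot g \<in> carrier Q"
      using in_V by (simp add: to_quot_def carrier_Quot)
    show "to_quot (g \<oplus>\<^bsub>P\<^esub> h) = to_quot g \<oplus>\<^bsub>Q\<^esub> to_quot h"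
      unfolding to_quot_def Q_simps(1)[OF in_V] by (simp add: multiply_out_add)
    show "to_quot (g \<otimes>\<^bsub>P\<^esub> h) = to_quot g \<otimes>\<^bsub>Q\<^esub> to_quot h"
      unfolding to_quot_def Q_simps(2)[OF in_V]
      using coset_PIdl_eq_iff[OF f_insert multiply_out_closed[OF P.m_closed[OF g h]] indets_mult[OF in_V]]
        multiply_out_mult[OF g h] by simp
  next
    have one: "indets 1 \<subseteq> V"
      by simp
    have Q_one: "\<one>\<^bsub>Q\<^esub> = Qcls 1" and R_one: "\<one>\<^bsub>R\<^esub> = cls 1"
      by (simp_all add: FactRing_def)
    have "multiply_out \<one>\<^bsub>P\<^esub> = rep (cls 1)"
      unfolding pair_alg_simps(4) R_one by (simp add: multiply_out_single)
    moreover have "Qcls (rep (cls 1)) = Qcls 1"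
      using coset_PIdl_eq_iff[OF f_insert, of "rep (cls 1)" 1] rep_coset(1,2)[OF one] by auto
    ultimately show "to_quot \<one>\<^bsub>P\<^esub> = \<one>\<^bsub>Q\<^esub>"
      by (simp only: to_quot_def Q_one)
  qed
  moreover have "to_quot (c \<odot>\<^bsub>P\<^esub> g) = c \<odot>\<^bsub>Q\<^esub> to_quot g" if g: "g \<in> carrier P" for c g
    using Q_simps(3)[OF multiply_out_closed[OF g] multiply_out_closed[OF g]]
    by (simp add: to_quot_def multiply_out_scale)
  ultimately show ?thesis
    by (simp add: alg_hom_def)
qed

lemma to_quot_zero_iff: "g \<in> carrier P \<Longrightarrow> to_quot g = \<zero>\<^bsub>Q\<^esub> \<longleftrightarrow> f dvd multiply_out g"
  unfolding to_quot_def by (rule coset_PIdl_zero_iff[OF f_insert multiply_out_closed])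

text \<open>
  The relations multiply out to multiples of \<open>f\<close>, so the ideal they generate is contained in the
  kernel. Conversely, if \<open>g\<close> multiplies out to \<open>f q\<close>, then \<open>g\<close> agrees modulo \<open>K\<close> with the monomialwise
  image of \<open>f q\<close>, which is zero modulo \<open>K\<close>.
\<close>

lemma kernel_to_quot: "\<forall>g\<in>carrier P. to_quot g = \<zero>\<^bsub>Q\<^esub> \<longleftrightarrow> g \<in> K"
proof
  fix g
  assume g: "g \<in> carrier P"
  interpret ring_hom_ring P Q to_quot
    using to_quot_alg_hom by (intro ring_hom_ringI2 P.ring_axioms Q.ring_axioms) (simp add: alg_hom_def)
  have "K \<subseteq> a_kernel P Q to_quot"
  proof (rule P.genideal_minimal[OF kernel_is_ideal])
    show "tensor_relations R (poly_alg {w}) \<subseteq> a_kernel P Q to_quot"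
      using relations_closed multiply_out_relations to_quot_zero_iff
      unfolding a_kernel_def' by blast
  qed
  moreover have "g \<in> K" if dvd: "f dvd multiply_out g"
  proof -
    have "multiply_out g \<in> PIdl\<^bsub>poly_alg (insert w V)\<^esub> f"
      using mem_PIdl_iff[OF f_insert multiply_out_closed[OF g]] dvd by blast
    then obtain q where "indets q \<subseteq> insert w V" "multiply_out g = f * q"
      by (auto simp: cgenideal_def mult.commute)
    then have "tensor_eq g 0"
      using tensor_eq_trans[OF tensor_eq_multiply_out[OF g]] monomialwise_multiple by simp
    then show ?thesis
      by (simp add: tensor_eq_def)
  qed
  ultimately show "to_quot g = \<zero>\<^bsub>Q\<^esub> \<longleftrightarrow> g \<in> K"
    using g to_quot_zero_iff[OF g] unfolding a_kernel_def' by blast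
qed

lemma surj_to_quot: "carrier Q \<subseteq> to_quot ` carrier P"
proof
  fix U
  assume "U \<in> carrier Q"
  then obtain p where p: "indets p \<subseteq> insert w V" "U = Qcls p"
    by (auto simp: carrier_Quot)
  have "U = to_quot (monomialwise p)"
    unfolding to_quot_def p(2)
    using coset_PIdl_eq_iff[OF f_insert multiply_out_closed[OF monomialwise_closed[OF p(1)]] p(1)]
      multiply_out_monomialwise[OF p(1)] by simp
  then show "U \<in> to_quot ` carrier P"
    using monomialwise_closed[OF p(1)] by blast
qed

lemma tensor_isomorphic: "alg_isomorphic (tensor_alg R (poly_alg {w})) Q"
proof -
  note iso = P.first_isomorphism[OF Q.k_alg_axioms to_quot_alg_hom surj_to_quot ideal_K kernel_to_quot]
  interpret ideal K P by (rule ideal_K)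
  have "(\<Union>h \<in> K +>\<^bsub>P\<^esub> g. to_quot h) = to_quot g" if "g \<in> carrier P" for g
    using iso(1)[OF that] a_rcos_self[OF that] by blast
  then have "(\<lambda>U. \<Union>h\<in>U. to_quot h) \<in> alg_iso (alg_quot P K) Q"
    by (rule iso(2))
  then show ?thesis
    by (auto simp: alg_isomorphic_def tensor_alg_def)
qed

lemma tensor_k_alg: "k_alg (tensor_alg R (poly_alg {w}))"
  unfolding tensor_alg_def by (rule P.alg_quot_k_alg[OF ideal_K])

end

section \<open>The tensor products of the algebras with a polynomial ring\<close>

lemma tensor_Ralg_isomorphic:
  "alg_isomorphic (tensor_alg (Ralg n e) (poly_alg {IT})) (alg_quot k4 (PIdl\<^bsub>k4\<^esub> (Fpoly n e)))"
  "k_alg (tensor_alg (Ralg n e) (poly_alg {IT}))"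
proof -
  interpret adjoin_indet "{IX, IY, IZ}" IT "Fpoly n e"
    by unfold_locales (simp, rule indets_Fpoly, simp)
  have "insert IT {IX, IY, IZ} = {IX, IY, IZ, IT}"
    by blast
  then show "alg_isomorphic (tensor_alg (Ralg n e) (poly_alg {IT})) (alg_quot k4 (PIdl\<^bsub>k4\<^esub> (Fpoly n e)))"
    using tensor_isomorphic by (simp only: Ralg_def)
  show "k_alg (tensor_alg (Ralg n e) (poly_alg {IT}))"
    using tensor_k_alg by (simp only: Ralg_def)
qed

lemma tensor_Ralg_isomorphic_le:
  assumes "n \<ge> 1" "e1 \<ge> 1" "e1 \<le> e2"
  shows "alg_isomorphic
    (tensor_alg (Ralg n e1 :: ('k::field_char_0, 'k mp set) module) (poly_alg {IT}))
    (tensor_alg (Ralg n e2 :: ('k, 'k mp set) module) (poly_alg {IT}))"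
proof -
  have "induces_iso (phi_comp n e1 (e2 - e1)) (Fpoly n e1) (Fpoly n e2 :: 'k mp)"
    using phi_comp_induces_iso[OF assms(1,2), of "e2 - e1"] assms(3) by simp
  then have "alg_isomorphic (alg_quot k4 (PIdl\<^bsub>k4\<^esub> (Fpoly n e1 :: 'k mp)))
      (alg_quot k4 (PIdl\<^bsub>k4\<^esub> (Fpoly n e2)))"
    unfolding induces_iso_def alg_isomorphic_def by blast
  then have "alg_isomorphic (tensor_alg (Ralg n e1 :: ('k, 'k mp set) module) (poly_alg {IT}))
      (alg_quot k4 (PIdl\<^bsub>k4\<^esub> (Fpoly n e2)))"
    by (rule alg_isomorphic_trans[OF tensor_Ralg_isomorphic(1)])
  then show ?thesis
    by (rule alg_isomorphic_trans[OF _ alg_isomorphic_sym[OF tensor_Ralg_isomorphic]])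
qed

theorem theorem5p3:
  fixes n :: nat
  assumes "n \<ge> 1"
  shows "(\<forall>e1 \<ge> 1. \<forall>e2 \<ge> 1.
            alg_isomorphic
              (tensor_alg (Ralg n e1 :: ('k::field_char_0, 'k mp set) module) (poly_alg {IT}))
              (tensor_alg (Ralg n e2 :: ('k, 'k mp set) module) (poly_alg {IT}))) \<and>
         (\<forall>e1 \<ge> 1. \<forall>e2 > e1.
            induces_iso (phi_comp n e1 (e2 - e1) :: 'k mp \<Rightarrow> 'k mp) (Fpoly n e1) (Fpoly n e2))"
proof (intro conjI allI impI)
  fix e1 e2 :: nat
  assume e: "e1 \<ge> 1" "e2 \<ge> 1"
  show "alg_isomorphic
      (tensor_alg (Ralg n e1 :: ('k, 'k mp set) module) (poly_alg {IT}))
      (tensor_alg (Ralg n e2 :: ('k, 'k mp set) module) (poly_alg {IT}))"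
  proof (cases "e1 \<le> e2")
    case True
    then show ?thesis
      by (rule tensor_Ralg_isomorphic_le[OF assms e(1)])
  next
    case False
    then have "e2 \<le> e1"
      by simp
    from tensor_Ralg_isomorphic_le[OF assms e(2) this] show ?thesis
      by (rule alg_isomorphic_sym[OF _ tensor_Ralg_isomorphic(2)])
  qed
next
  fix e1 e2 :: nat
  assume "e1 \<ge> 1" "e2 > e1"
  then show "induces_iso (phi_comp n e1 (e2 - e1) :: 'k mp \<Rightarrow> 'k mp) (Fpoly n e1) (Fpoly n e2)"
    using phi_comp_induces_iso[OF assms, of e1 "e2 - e1"] by simp
qed

end
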